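(* Let $p$ be an odd prime and $n\ge0$ an integer. Let $K$ be the complete graph on the vertices $\{1,2,2p,2p^2,\dots,2p^n\}$ considered as a directed graph, with edges labelled by elements of $A^\vee(n)$ as in the context; each directed path is identified with the product in $A^\vee(n)$ of the labels of its edges. I. For $i\ge1$, $j\ge0$ with $i+j\le n$, the antipode $c(\xi_i^{p^j})\in A^\vee(n)$ is the signed sum of all directed paths from the vertex $2p^j$ to the vertex $2p^{i+j}$ in $K$. The positive terms in the sum correspond exactly to the paths consisting of an even number of edges from the vertex $2p^j$ to the vertex $2p^{i+j}$ (paths with an odd number of edges have sign $-1$). II. Similarly, for $0\le i\le n$, the antipode $c(\tau_i)\in A^\vee(n)$ is the signed sum of all directed paths from the vertex $1$ to the vertex $2p^i$ in $K$. The positive terms correspond exactly to the paths consisting of an even number of edges from the vertex $1$ to the vertex $2p^i$.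
   Context: $A^\vee(n)=\mathbb{F}_p[\xi_1,\dots,\xi_n,\tau_0,\dots,\tau_n]/(\xi_1^{p^n},\xi_2^{p^{n-1}},\dots,\xi_n^{p},\tau_0^2,\dots,\tau_n^2)$ (the $\tau_i$ are exterior generators) is a graded-commutative quotient Hopf algebra over $\mathbb{F}_p$ of the mod $p$ dual Steenrod algebra, with $|\xi_i|=2(p^i-1)$, $|\tau_i|=2p^i-1$ and coproduct $\psi(\xi_m)=\sum_{k=0}^m\xi_{m-k}^{p^k}\otimes\xi_k$, $\psi(\tau_m)=\tau_m\otimes1+\sum_{k=0}^m\xi_{m-k}^{p^k}\otimes\tau_k$, where $\xi_0=1$. Its antipode $c:A^\vee(n)\to A^\vee(n)$ is the algebra map determined by $c(\xi_0)=1$, $c(\xi_m)=-\xi_m-\sum_{k=1}^{m-1}\xi_{m-k}^{p^k}c(\xi_k)$ for $m\ge1$, and $c(\tau_m)=-\tau_m-\sum_{k=0}^{m-1}\xi_{m-k}^{p^k}c(\tau_k)$ for $m\ge0$. In the complete directed graph $K$, every edge is directed towards its larger end; the edge $2p^a\to2p^b$ ($a<b$) is labelled $\xi_{b-a}^{p^a}$ and the edge $1\to2p^a$ is labelled $\tau_a$. Directed paths here are non-degenerate (no loops). *)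

theory Defs
  imports "HOL-Number_Theory.Residues" "HOL-Algebra.QuotRing" "Graph_Theory.Pair_Digraph"
begin

section \<open>Free associative algebras\<close>

text \<open>The free associative unital algebra over \<open>R\<close> on the set of letters \<open>X\<close>: finitely
  supported functions from words over \<open>X\<close> to \<open>R\<close>, multiplied by convolution with respect to
  concatenation of words (the sum runs over all ways of cutting \<open>w\<close> into two words).\<close>

definition free_algebra :: "('r, 'm) ring_scheme \<Rightarrow> 'x set \<Rightarrow> ('x list \<Rightarrow> 'r) ring" where
  "free_algebra R X =
    \<lparr>carrier = {f. range f \<subseteq> carrier R \<and> finite {w. f w \<noteq> \<zero>\<^bsub>R\<^esub>} \<and> {w. f w \<noteq> \<zero>\<^bsub>R\<^esub>} \<subseteq> lists X},
     monoid.mult = (\<lambda>f g w. \<Oplus>\<^bsub>R\<^esub>i\<in>{..length w}. f (take i w) \<otimes>\<^bsub>R\<^esub> g (drop i w)),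
     one = (\<lambda>w. if w = [] then \<one>\<^bsub>R\<^esub> else \<zero>\<^bsub>R\<^esub>),
     zero = (\<lambda>w. \<zero>\<^bsub>R\<^esub>),
     add = (\<lambda>f g w. f w \<oplus>\<^bsub>R\<^esub> g w)\<rparr>"

definition free_gen :: "('r, 'm) ring_scheme \<Rightarrow> 'x \<Rightarrow> 'x list \<Rightarrow> 'r" where
  "free_gen R x = (\<lambda>w. if w = [x] then \<one>\<^bsub>R\<^esub> else \<zero>\<^bsub>R\<^esub>)"

context ring
begin

lemma free_algebra_carrier_iff:
  "f \<in> carrier (free_algebra R X) \<longleftrightarrow>
    (\<forall>w. f w \<in> carrier R) \<and> finite {w. f w \<noteq> \<zero>} \<and> (\<forall>w. f w \<noteq> \<zero> \<longrightarrow> w \<in> lists X)"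
  by (auto simp: free_algebra_def image_subset_iff)

lemma free_algebra_triangle_sum:
  fixes L :: nat
  assumes h: "\<And>k j. k + j \<le> L \<Longrightarrow> h k j \<in> carrier R"
  shows "(\<Oplus>i\<in>{..L}. \<Oplus>k\<in>{..i}. h k (i - k)) = (\<Oplus>k\<in>{..L}. \<Oplus>j\<in>{..L - k}. h k j)"
  using h
proof (induction L)
  case 0
  then show ?case by simp
next
  case (Suc L)
  have c: "h k j \<in> carrier R" if "k + j \<le> Suc L" for k j
    using Suc.prems that by blast
  have IH: "(\<Oplus>i\<in>{..L}. \<Oplus>k\<in>{..i}. h k (i - k)) = (\<Oplus>k\<in>{..L}. \<Oplus>j\<in>{..L - k}. h k j)"
    by (rule Suc.IH) (simp add: c)
  have "(\<Oplus>k\<in>{..L}. \<Oplus>j\<in>{..Suc L - k}. h k j)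
      = (\<Oplus>k\<in>{..L}. h k (Suc L - k) \<oplus> (\<Oplus>j\<in>{..L - k}. h k j))"
  proof (rule add.finprod_cong')
    fix k assume k: "k \<in> {..L}"
    then have "Suc L - k = Suc (L - k)" by auto
    then show "(\<Oplus>j\<in>{..Suc L - k}. h k j) = h k (Suc L - k) \<oplus> (\<Oplus>j\<in>{..L - k}. h k j)"
      using k by (simp only:) (rule finsum_Suc, auto intro!: c)
  qed (auto intro!: c add.finprod_closed)
  also have "\<dots> = (\<Oplus>k\<in>{..L}. h k (Suc L - k)) \<oplus> (\<Oplus>k\<in>{..L}. \<Oplus>j\<in>{..L - k}. h k j)"
    by (rule finsum_addf) (auto intro!: c add.finprod_closed)
  finally have 1: "(\<Oplus>k\<in>{..L}. \<Oplus>j\<in>{..Suc L - k}. h k j) =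
      (\<Oplus>k\<in>{..L}. h k (Suc L - k)) \<oplus> (\<Oplus>k\<in>{..L}. \<Oplus>j\<in>{..L - k}. h k j)" .
  have 2: "(\<Oplus>i\<in>{..Suc L}. \<Oplus>k\<in>{..i}. h k (i - k)) =
      (\<Oplus>k\<in>{..Suc L}. h k (Suc L - k)) \<oplus> (\<Oplus>i\<in>{..L}. \<Oplus>k\<in>{..i}. h k (i - k))"
    by (rule finsum_Suc) (auto intro!: c add.finprod_closed)
  have 3: "(\<Oplus>k\<in>{..Suc L}. h k (Suc L - k)) = h (Suc L) 0 \<oplus> (\<Oplus>k\<in>{..L}. h k (Suc L - k))"
    by (subst finsum_Suc) (auto intro!: c)
  have "finsum R (h (Suc L)) {0} = h (Suc L) 0"
    using add.finprod_insert[of "{}" 0 "h (Suc L)"] c[of "Suc L" 0] by simp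
  then have 4: "(\<Oplus>k\<in>{..Suc L}. \<Oplus>j\<in>{..Suc L - k}. h k j) =
      h (Suc L) 0 \<oplus> (\<Oplus>k\<in>{..L}. \<Oplus>j\<in>{..Suc L - k}. h k j)"
    by (subst finsum_Suc) (auto intro!: c add.finprod_closed)
  show ?case
    unfolding 2 3 4 1 IH
    by (rule a_assoc) (auto intro!: c add.finprod_closed)
qed

lemma free_algebra_mult_support:
  assumes "f \<in> carrier (free_algebra R X)" "g \<in> carrier (free_algebra R X)"
  shows "{w. (f \<otimes>\<^bsub>free_algebra R X\<^esub> g) w \<noteq> \<zero>} \<subseteq>
    (\<lambda>(u, v). u @ v) ` ({w. f w \<noteq> \<zero>} \<times> {w. g w \<noteq> \<zero>})"
proof
  fix w assume w: "w \<in> {w. (f \<otimes>\<^bsub>free_algebra R X\<^esub> g) w \<noteq> \<zero>}"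
  have c: "f u \<in> carrier R" "g u \<in> carrier R" for u
    using assms by (auto simp: free_algebra_def)
  have "\<exists>i\<in>{..length w}. f (take i w) \<otimes> g (drop i w) \<noteq> \<zero>"
  proof (rule ccontr)
    assume "\<not> ?thesis"
    then have "(\<Oplus>i\<in>{..length w}. f (take i w) \<otimes> g (drop i w)) = (\<Oplus>i\<in>{..length w}. \<zero>)"
      by (intro add.finprod_cong') auto
    then show False using w by (simp add: free_algebra_def)
  qed
  then obtain i where "f (take i w) \<otimes> g (drop i w) \<noteq> \<zero>" by blast
  then have "f (take i w) \<noteq> \<zero>" "g (drop i w) \<noteq> \<zero>" using c by auto
  then show "w \<in> (\<lambda>(u, v). u @ v) ` ({w. f w \<noteq> \<zero>} \<times> {w. g w \<noteq> \<zero>})"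
    by (intro image_eqI[of _ _ "(take i w, drop i w)"]) auto
qed

lemma free_algebra_mult_closed:
  assumes f: "f \<in> carrier (free_algebra R X)" and g: "g \<in> carrier (free_algebra R X)"
  shows "f \<otimes>\<^bsub>free_algebra R X\<^esub> g \<in> carrier (free_algebra R X)"
proof -
  have "range (f \<otimes>\<^bsub>free_algebra R X\<^esub> g) \<subseteq> carrier R"
    using f g unfolding free_algebra_carrier_iff
    by (auto simp: free_algebra_def intro!: finsum_closed)
  moreover have "finite {w. (f \<otimes>\<^bsub>free_algebra R X\<^esub> g) w \<noteq> \<zero>}"
    using f g by (intro finite_subset[OF free_algebra_mult_support[OF f g]])
      (auto simp: free_algebra_def)
  moreover have "{w. (f \<otimes>\<^bsub>free_algebra R X\<^esub> g) w \<noteq> \<zero>} \<subseteq> lists X"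
  proof -
    have "(\<lambda>(u, v). u @ v) ` ({w. f w \<noteq> \<zero>} \<times> {w. g w \<noteq> \<zero>}) \<subseteq> lists X"
      using f g by (fastforce simp: free_algebra_def)
    then show ?thesis using free_algebra_mult_support[OF f g] by blast
  qed
  ultimately show ?thesis by (simp add: free_algebra_def)
qed

lemma free_algebra_ring: "ring (free_algebra R X)"
proof (rule ringI)
  let ?F = "free_algebra R X"
  have c: "f w \<in> carrier R" if "f \<in> carrier ?F" for f w
    using that by (auto simp: free_algebra_def)
  have add_c: "f \<oplus>\<^bsub>?F\<^esub> g \<in> carrier ?F" if f: "f \<in> carrier ?F" and g: "g \<in> carrier ?F" for f g
  proof -
    have "{w. f w \<oplus> g w \<noteq> \<zero>} \<subseteq> {w. f w \<noteq> \<zero>} \<union> {w. g w \<noteq> \<zero>}" by auto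
    then have "finite {w. f w \<oplus> g w \<noteq> \<zero>}"
      using f g by (auto simp: free_algebra_carrier_iff intro: finite_subset)
    moreover have "w \<in> lists X" if "f w \<oplus> g w \<noteq> \<zero>" for w
    proof -
      have "f w \<noteq> \<zero> \<or> g w \<noteq> \<zero>" using that by auto
      then show ?thesis using f g by (auto simp only: free_algebra_carrier_iff)
    qed
    moreover have "(f \<oplus>\<^bsub>?F\<^esub> g) w = f w \<oplus> g w" for w
      by (simp add: free_algebra_def)
    ultimately show ?thesis
      using c[OF f] c[OF g] by (simp only: free_algebra_carrier_iff) simp
  qed
  show "abelian_group ?F"
  proof (rule abelian_groupI)
    show "\<exists>g\<in>carrier ?F. g \<oplus>\<^bsub>?F\<^esub> f = \<zero>\<^bsub>?F\<^esub>" if f: "f \<in> carrier ?F" for f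
    proof (rule bexI[of _ "\<lambda>w. \<ominus> f w"])
      show "(\<lambda>w. \<ominus> f w) \<oplus>\<^bsub>?F\<^esub> f = \<zero>\<^bsub>?F\<^esub>"
        using c[OF f] by (simp add: free_algebra_def l_neg)
      have "{w. \<ominus> f w \<noteq> \<zero>} \<subseteq> {w. f w \<noteq> \<zero>}" by auto
      then show "(\<lambda>w. \<ominus> f w) \<in> carrier ?F"
        using f by (auto simp: free_algebra_def intro: finite_subset)
    qed
  qed (auto simp: add_c, auto simp: free_algebra_def a_ac image_subset_iff)
  show "Group.monoid ?F"
  proof (rule monoidI)
    show "\<one>\<^bsub>?F\<^esub> \<in> carrier ?F"
      by (auto simp: free_algebra_def)
    fix f assume f: "f \<in> carrier ?F"
    show "\<one>\<^bsub>?F\<^esub> \<otimes>\<^bsub>?F\<^esub> f = f"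
    proof
      fix w
      have "(\<Oplus>i\<in>{..length w}. (if take i w = [] then \<one> else \<zero>) \<otimes> f (drop i w))
          = (\<Oplus>i\<in>{..length w}. if 0 = i then f (drop i w) else \<zero>)"
        using c[OF f] by (intro add.finprod_cong') auto
      also have "\<dots> = f (drop 0 w)"
        using c[OF f] by (intro add.finprod_singleton) auto
      finally show "(\<one>\<^bsub>?F\<^esub> \<otimes>\<^bsub>?F\<^esub> f) w = f w"
        by (simp add: free_algebra_def)
    qed
    show "f \<otimes>\<^bsub>?F\<^esub> \<one>\<^bsub>?F\<^esub> = f"
    proof
      fix w
      have "(\<Oplus>i\<in>{..length w}. f (take i w) \<otimes> (if drop i w = [] then \<one> else \<zero>))
          = (\<Oplus>i\<in>{..length w}. if length w = i then f (take i w) else \<zero>)"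
        using c[OF f] by (intro add.finprod_cong') auto
      also have "\<dots> = f (take (length w) w)"
        using c[OF f] by (intro add.finprod_singleton) auto
      finally show "(f \<otimes>\<^bsub>?F\<^esub> \<one>\<^bsub>?F\<^esub>) w = f w"
        by (simp add: free_algebra_def)
    qed
    fix g h assume g: "g \<in> carrier ?F" and h: "h \<in> carrier ?F"
    show "f \<otimes>\<^bsub>?F\<^esub> g \<otimes>\<^bsub>?F\<^esub> h = f \<otimes>\<^bsub>?F\<^esub> (g \<otimes>\<^bsub>?F\<^esub> h)"
    proof
      fix w
      let ?t = "\<lambda>k j. f (take k w) \<otimes> (g (take j (drop k w)) \<otimes> h (drop (k + j) w))"
      have "(f \<otimes>\<^bsub>?F\<^esub> g \<otimes>\<^bsub>?F\<^esub> h) w = (\<Oplus>i\<in>{..length w}.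
          (\<Oplus>k\<in>{..length (take i w)}. f (take k (take i w)) \<otimes> g (drop k (take i w))) \<otimes> h (drop i w))"
        by (simp add: free_algebra_def)
      also have "\<dots> = (\<Oplus>i\<in>{..length w}. \<Oplus>k\<in>{..i}. ?t k (i - k))"
      proof (rule add.finprod_cong')
        fix i assume "i \<in> {..length w}"
        then have i: "length (take i w) = i" by simp
        have "(\<Oplus>k\<in>{..i}. f (take k (take i w)) \<otimes> g (drop k (take i w))) \<otimes> h (drop i w)
            = (\<Oplus>k\<in>{..i}. f (take k (take i w)) \<otimes> g (drop k (take i w)) \<otimes> h (drop i w))"
          by (rule finsum_ldistr) (simp_all add: Pi_def c[OF f] c[OF g] c[OF h])
        also have "\<dots> = (\<Oplus>k\<in>{..i}. ?t k (i - k))"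
          by (rule add.finprod_cong')
            (simp_all add: Pi_def min_def drop_take m_assoc c[OF f] c[OF g] c[OF h])
        finally show "(\<Oplus>k\<in>{..length (take i w)}. f (take k (take i w)) \<otimes> g (drop k (take i w)))
            \<otimes> h (drop i w) = (\<Oplus>k\<in>{..i}. ?t k (i - k))"
          unfolding i .
      qed (simp_all add: Pi_def c[OF f] c[OF g] c[OF h])
      also have "\<dots> = (\<Oplus>k\<in>{..length w}. \<Oplus>j\<in>{..length w - k}. ?t k j)"
        by (rule free_algebra_triangle_sum) (simp_all add: Pi_def c[OF f] c[OF g] c[OF h])
      also have "\<dots> = (\<Oplus>k\<in>{..length w}. f (take k w) \<otimes>
          (\<Oplus>j\<in>{..length (drop k w)}. g (take j (drop k w)) \<otimes> h (drop j (drop k w))))"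
      proof (rule add.finprod_cong')
        fix k
        have "f (take k w) \<otimes> (\<Oplus>j\<in>{..length w - k}. g (take j (drop k w)) \<otimes> h (drop (k + j) w))
           = (\<Oplus>j\<in>{..length w - k}. ?t k j)"
          by (rule finsum_rdistr) (simp_all add: Pi_def c[OF f] c[OF g] c[OF h])
        then show "(\<Oplus>j\<in>{..length w - k}. ?t k j) = f (take k w) \<otimes>
          (\<Oplus>j\<in>{..length (drop k w)}. g (take j (drop k w)) \<otimes> h (drop j (drop k w)))"
          by (simp add: add.commute)
      qed (simp_all add: Pi_def c[OF f] c[OF g] c[OF h])
      also have "\<dots> = (f \<otimes>\<^bsub>?F\<^esub> (g \<otimes>\<^bsub>?F\<^esub> h)) w"
        by (simp add: free_algebra_def)
      finally show "(f \<otimes>\<^bsub>?F\<^esub> g \<otimes>\<^bsub>?F\<^esub> h) w = (f \<otimes>\<^bsub>?F\<^esub> (g \<otimes>\<^bsub>?F\<^esub> h)) w" .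
    qed
  qed (rule free_algebra_mult_closed)
  fix f g h assume f: "f \<in> carrier ?F" and g: "g \<in> carrier ?F" and h: "h \<in> carrier ?F"
  show "(f \<oplus>\<^bsub>?F\<^esub> g) \<otimes>\<^bsub>?F\<^esub> h = f \<otimes>\<^bsub>?F\<^esub> h \<oplus>\<^bsub>?F\<^esub> g \<otimes>\<^bsub>?F\<^esub> h"
    by (simp add: free_algebra_def l_distr finsum_addf Pi_def c[OF f] c[OF g] c[OF h])
  show "h \<otimes>\<^bsub>?F\<^esub> (f \<oplus>\<^bsub>?F\<^esub> g) = h \<otimes>\<^bsub>?F\<^esub> f \<oplus>\<^bsub>?F\<^esub> h \<otimes>\<^bsub>?F\<^esub> g"
    by (simp add: free_algebra_def r_distr finsum_addf Pi_def c[OF f] c[OF g] c[OF h])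
qed

end


section \<open>The quotient of the dual Steenrod algebra\<close>

datatype gen = Xi nat | Tau nat

definition gens :: "nat \<Rightarrow> gen set" where
  "gens n = Xi ` {1..n} \<union> Tau ` {0..n}"

fun deg :: "nat \<Rightarrow> gen \<Rightarrow> nat" where
  "deg p (Xi i) = 2 * (p ^ i - 1)"
| "deg p (Tau i) = 2 * p ^ i - 1"

abbreviation free_alg :: "nat \<Rightarrow> nat \<Rightarrow> (gen list \<Rightarrow> int) ring" where
  "free_alg p n \<equiv> free_algebra (residue_ring (int p)) (gens n)"

abbreviation fgen :: "nat \<Rightarrow> gen \<Rightarrow> gen list \<Rightarrow> int" where
  "fgen p \<equiv> free_gen (residue_ring (int p))"

text \<open>The first family of relations is graded commutativity
  \<open>a b = (-1)\<^bsup>|a| |b|\<^esup> b a\<close>; together with \<open>\<tau>\<^sub>i\<^sup>2 = 0\<close> it makes the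
  algebra polynomial on the \<open>\<xi>\<^sub>i\<close> and exterior on the \<open>\<tau>\<^sub>i\<close>, before truncation of the \<open>\<xi>\<^sub>i\<close>.\<close>

definition relations :: "nat \<Rightarrow> nat \<Rightarrow> (gen list \<Rightarrow> int) set" where
  "relations p n =
     {fgen p a \<otimes>\<^bsub>free_alg p n\<^esub> fgen p b \<ominus>\<^bsub>free_alg p n\<^esub>
        add_pow (free_alg p n) ((-1 :: int) ^ (deg p a * deg p b)) (fgen p b \<otimes>\<^bsub>free_alg p n\<^esub> fgen p a)
      | a b. a \<in> gens n \<and> b \<in> gens n}
   \<union> {fgen p (Xi i) [^]\<^bsub>free_alg p n\<^esub> (p ^ (n + 1 - i)) | i. i \<in> {1..n}}
   \<union> {fgen p (Tau i) [^]\<^bsub>free_alg p n\<^esub> (2::nat) | i. i \<in> {0..n}}"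

definition rel_ideal :: "nat \<Rightarrow> nat \<Rightarrow> (gen list \<Rightarrow> int) set" where
  "rel_ideal p n = genideal (free_alg p n) (relations p n)"

definition Adual :: "nat \<Rightarrow> nat \<Rightarrow> (gen list \<Rightarrow> int) set ring" where
  "Adual p n = free_alg p n Quot rel_ideal p n"

definition \<xi> :: "nat \<Rightarrow> nat \<Rightarrow> nat \<Rightarrow> (gen list \<Rightarrow> int) set" where
  "\<xi> p n i = (if i = 0 then \<one>\<^bsub>Adual p n\<^esub> else rel_ideal p n +>\<^bsub>free_alg p n\<^esub> fgen p (Xi i))"

definition \<tau> :: "nat \<Rightarrow> nat \<Rightarrow> nat \<Rightarrow> (gen list \<Rightarrow> int) set" where
  "\<tau> p n i = rel_ideal p n +>\<^bsub>free_alg p n\<^esub> fgen p (Tau i)"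

text \<open>Unital ring endomorphisms of an algebra over a prime field are automatically linear, so
  \<^const>\<open>ring_hom\<close> is the set of algebra maps.\<close>

definition is_antipode ::
    "nat \<Rightarrow> nat \<Rightarrow> ((gen list \<Rightarrow> int) set \<Rightarrow> (gen list \<Rightarrow> int) set) \<Rightarrow> bool" where
  "is_antipode p n c \<longleftrightarrow>
     c \<in> ring_hom (Adual p n) (Adual p n) \<and>
     c (\<xi> p n 0) = \<one>\<^bsub>Adual p n\<^esub> \<and>
     (\<forall>m\<in>{1..n}. c (\<xi> p n m) = \<ominus>\<^bsub>Adual p n\<^esub> \<xi> p n m \<ominus>\<^bsub>Adual p n\<^esub>
        (\<Oplus>\<^bsub>Adual p n\<^esub>k\<in>{1..<m}.
           \<xi> p n (m - k) [^]\<^bsub>Adual p n\<^esub> (p ^ k) \<otimes>\<^bsub>Adual p n\<^esub> c (\<xi> p n k))) \<and>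
     (\<forall>m\<in>{0..n}. c (\<tau> p n m) = \<ominus>\<^bsub>Adual p n\<^esub> \<tau> p n m \<ominus>\<^bsub>Adual p n\<^esub>
        (\<Oplus>\<^bsub>Adual p n\<^esub>k\<in>{0..<m}.
           \<xi> p n (m - k) [^]\<^bsub>Adual p n\<^esub> (p ^ k) \<otimes>\<^bsub>Adual p n\<^esub> c (\<tau> p n k)))"

text \<open>Restricting to \<^const>\<open>extensional\<close> functions only fixes the irrelevant values outside the
  carrier, so that the algebra map is unique as a HOL function.\<close>

definition antipode ::
    "nat \<Rightarrow> nat \<Rightarrow> (gen list \<Rightarrow> int) set \<Rightarrow> (gen list \<Rightarrow> int) set" where
  "antipode p n = (THE c. c \<in> extensional (carrier (Adual p n)) \<and> is_antipode p n c)"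


section \<open>The labelled complete digraph\<close>

definition K :: "nat \<Rightarrow> nat \<Rightarrow> nat pair_pre_digraph" where
  "K p n =
    (let V = insert 1 ((\<lambda>a. 2 * p ^ a) ` {0..n})
     in \<lparr>pverts = V, parcs = {(u, v). u \<in> V \<and> v \<in> V \<and> u < v}\<rparr>)"

text \<open>The exponent \<open>a\<close> of a vertex \<open>2 p\<^sup>a\<close>.\<close>

definition vexp :: "nat \<Rightarrow> nat \<Rightarrow> nat" where
  "vexp p v = (THE a. v = 2 * p ^ a)"

definition edge_label :: "nat \<Rightarrow> nat \<Rightarrow> nat \<times> nat \<Rightarrow> (gen list \<Rightarrow> int) set" where
  "edge_label p n = (\<lambda>(u, v).
     if u = 1 then \<tau> p n (vexp p v)
     else \<xi> p n (vexp p v - vexp p u) [^]\<^bsub>Adual p n\<^esub> (p ^ vexp p u))"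

text \<open>A path is the list of its arcs.\<close>

definition paths :: "nat \<Rightarrow> nat \<Rightarrow> nat \<Rightarrow> nat \<Rightarrow> (nat \<times> nat) list set" where
  "paths p n u v = {es. pre_digraph.apath (with_proj (K p n)) u es v}"

definition path_product :: "nat \<Rightarrow> nat \<Rightarrow> (nat \<times> nat) list \<Rightarrow> (gen list \<Rightarrow> int) set" where
  "path_product p n es =
     foldr (\<lambda>e x. edge_label p n e \<otimes>\<^bsub>Adual p n\<^esub> x) es \<one>\<^bsub>Adual p n\<^esub>"

definition signed_path_sum :: "nat \<Rightarrow> nat \<Rightarrow> nat \<Rightarrow> nat \<Rightarrow> (gen list \<Rightarrow> int) set" where
  "signed_path_sum p n u v =
     (\<Oplus>\<^bsub>Adual p n\<^esub>es\<in>paths p n u v.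
        if even (length es) then path_product p n es else \<ominus>\<^bsub>Adual p n\<^esub> path_product p n es)"

end

theory Submission
  imports Defs
begin

text \<open>Splitting off the last edge of a path, the signed path sums satisfy the same recursions as the
  values of the antipode on the generators. Since \<^const>\<open>antipode\<close> is a definite description, one has to show
  that these recursions define exactly one algebra endomorphism. Uniqueness is clear because the
  generators generate. For existence, the signed path sums must satisfy the defining relations: those
  for the \<open>\<xi>\<^sub>i\<close> are central, and by the Frobenius map each term of their recursion inherits
  the truncation from a power of some \<open>\<xi>\<^sub>k\<close>; those for the \<open>\<tau>\<^sub>i\<close> are combinations of the \<open>\<tau>\<^sub>k\<close>
  with central coefficients, so they anticommute, and their squares vanish because \<open>p\<close> is odd.
  Frobenius also turns the recursion for \<open>c(\<xi>\<^sub>i)\<close> into the one for \<open>c(\<xi>\<^sub>i)\<close> raised to the power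
  \<open>p ^ j\<close>, which is that of the paths starting at \<open>2 p ^ j\<close>.\<close>

section \<open>Presentations by generators and relations\<close>

context ring
begin

lemma free_gen_closed: "x \<in> X \<Longrightarrow> free_gen R x \<in> carrier (free_algebra R X)"
  by (auto simp: free_algebra_carrier_iff free_gen_def)

text \<open>With \<open>w = []\<close> this is the embedding of the coefficient ring as
  scalars.\<close>

definition monomial :: "'a \<Rightarrow> 'x list \<Rightarrow> 'x list \<Rightarrow> 'a" where
  "monomial r w = (\<lambda>u. if u = w then r else \<zero>)"

lemma monomial_closed:
  "r \<in> carrier R \<Longrightarrow> w \<in> lists X \<Longrightarrow> monomial r w \<in> carrier (free_algebra R X)"
  by (auto simp: free_algebra_carrier_iff monomial_def)

lemma free_algebra_apply_closed: "f \<in> carrier (free_algebra R X) \<Longrightarrow> f w \<in> carrier R"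
  by (simp add: free_algebra_carrier_iff)

lemma free_algebra_add_apply: "(f \<oplus>\<^bsub>free_algebra R X\<^esub> g) w = f w \<oplus> g w"
  by (simp add: free_algebra_def)

text \<open>A scalar lives on the empty word, so only the cut at position 0 contributes to the
  convolution.\<close>

lemma monomial_Nil_mult_apply:
  assumes "r \<in> carrier R" "g \<in> carrier (free_algebra R X)"
  shows "(monomial r [] \<otimes>\<^bsub>free_algebra R X\<^esub> g) w = r \<otimes> g w"
proof -
  have "(\<Oplus>i\<in>{..length w}. monomial r [] (take i w) \<otimes> g (drop i w))
      = (\<Oplus>i\<in>{..length w}. if 0 = i then r \<otimes> g (drop i w) else \<zero>)"
    using assms by (intro add.finprod_cong') (auto simp: monomial_def free_algebra_carrier_iff)
  also have "\<dots> = r \<otimes> g (drop 0 w)"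
    using assms by (intro add.finprod_singleton) (auto simp: free_algebra_carrier_iff)
  finally show ?thesis by (simp add: free_algebra_def)
qed

text \<open>Only the cut after the first letter contributes, and it does so exactly when that letter
  is \<open>x\<close>. The empty word has no such cut.\<close>

lemma free_gen_mult_apply:
  assumes "g \<in> carrier (free_algebra R X)"
  shows "(free_gen R x \<otimes>\<^bsub>free_algebra R X\<^esub> g) w =
    (if w \<noteq> [] \<and> hd w = x then g (tl w) else \<zero>)"
proof (cases w)
  case Nil
  then show ?thesis using assms
    by (simp add: free_algebra_def free_gen_def image_subset_iff)
next
  case (Cons y u)
  have eq: "take i (y # u) = [x] \<longleftrightarrow> i = 1 \<and> y = x" if "i \<le> length w" for i
    using that by (cases i) (auto simp: Cons)
  have "(\<Oplus>i\<in>{..length w}. free_gen R x (take i w) \<otimes> g (drop i w))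
      = (\<Oplus>i\<in>{..length w}. if 1 = i then (if y = x then g (drop i w) else \<zero>) else \<zero>)"
    using assms
    by (intro add.finprod_cong') (auto simp: free_gen_def free_algebra_carrier_iff Cons eq[unfolded Cons])
  also have "\<dots> = (if y = x then g (drop 1 w) else \<zero>)"
    using assms by (intro add.finprod_singleton) (auto simp: free_algebra_carrier_iff Cons)
  finally show ?thesis by (simp add: free_algebra_def Cons)
qed

lemma monomial_Cons:
  assumes "r \<in> carrier R" "w \<in> lists X"
  shows "monomial r (x # w) = free_gen R x \<otimes>\<^bsub>free_algebra R X\<^esub> monomial r w"
proof
  fix u
  show "monomial r (x # w) u = (free_gen R x \<otimes>\<^bsub>free_algebra R X\<^esub> monomial r w) u"
    using free_gen_mult_apply[OF monomial_closed[OF assms], of x u]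
    by (cases u) (auto simp: monomial_def)
qed

text \<open>Words are removed from the finite support one at a time. Each monomial arises from a
  scalar by multiplying with letters on the left.\<close>

lemma free_algebra_induct [consumes 1, case_names scalar gen add mult]:
  assumes f: "f \<in> carrier (free_algebra R X)"
    and scalar: "\<And>r. r \<in> carrier R \<Longrightarrow> P (monomial r [])"
    and gen: "\<And>x. x \<in> X \<Longrightarrow> P (free_gen R x)"
    and add: "\<And>f g. f \<in> carrier (free_algebra R X) \<Longrightarrow> g \<in> carrier (free_algebra R X) \<Longrightarrow>
      P f \<Longrightarrow> P g \<Longrightarrow> P (f \<oplus>\<^bsub>free_algebra R X\<^esub> g)"
    and mult: "\<And>f g. f \<in> carrier (free_algebra R X) \<Longrightarrow> g \<in> carrier (free_algebra R X) \<Longrightarrow>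
      P f \<Longrightarrow> P g \<Longrightarrow> P (f \<otimes>\<^bsub>free_algebra R X\<^esub> g)"
  shows "P f"
proof -
  have mono: "P (monomial r w)" if "w \<in> lists X" "r \<in> carrier R" for r w
    using that
    by (induction w) (auto simp: monomial_Cons[where X = X] intro!: scalar mult gen free_gen_closed monomial_closed)
  have "P f" if "finite S" "f \<in> carrier (free_algebra R X)" "{w. f w \<noteq> \<zero>} = S" for S f
    using that
  proof (induction S arbitrary: f rule: finite_induct)
    case empty
    then have "f = monomial \<zero> []" by (auto simp: monomial_def)
    then show ?case using scalar by simp
  next
    case (insert w S)
    \<comment> \<open>Erasing the coefficient at \<open>w\<close> leaves exactly the support
      \<open>S\<close> of the induction hypothesis.\<close>
    define g where "g = f(w := \<zero>)"
    have supp: "{u. g u \<noteq> \<zero>} = S" using insert by (auto simp: g_def)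
    then have g: "g \<in> carrier (free_algebra R X)"
      using insert by (auto simp: free_algebra_carrier_iff g_def split: if_splits)
    have w: "w \<in> lists X" "f w \<in> carrier R"
      using insert.prems by (auto simp only: free_algebra_carrier_iff)
    have "f = monomial (f w) w \<oplus>\<^bsub>free_algebra R X\<^esub> g"
      using insert.prems by (auto simp: fun_eq_iff g_def free_algebra_add_apply monomial_def free_algebra_apply_closed)
    then show ?case
      using add[OF monomial_closed[OF w(2,1)] g mono[OF w] insert.IH[OF g supp]] by simp
  qed
  then show ?thesis using f by (auto simp: free_algebra_carrier_iff)
qed

end

section \<open>Evaluation of the free algebra at prescribed images of the letters\<close>

locale free_algebra_eval = ring_hom_ring R S h
  for R (structure) and S (structure) and h +
  fixes X :: "'x set" and v
  assumes v_closed: "x \<in> X \<Longrightarrow> v x \<in> carrier S"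
    and h_central: "r \<in> carrier R \<Longrightarrow> a \<in> carrier S \<Longrightarrow> h r \<otimes>\<^bsub>S\<^esub> a = a \<otimes>\<^bsub>S\<^esub> h r"
begin

definition word_val where
  "word_val w = foldr (\<lambda>x a. v x \<otimes>\<^bsub>S\<^esub> a) w \<one>\<^bsub>S\<^esub>"

definition eval_hom where
  "eval_hom f = (\<Oplus>\<^bsub>S\<^esub>w\<in>{w. f w \<noteq> \<zero>\<^bsub>R\<^esub>}. h (f w) \<otimes>\<^bsub>S\<^esub> word_val w)"

lemma word_val_simps [simp]:
  "word_val [] = \<one>\<^bsub>S\<^esub>" "word_val (x # w) = v x \<otimes>\<^bsub>S\<^esub> word_val w"
  by (simp_all add: word_val_def)

lemma word_val_closed: "w \<in> lists X \<Longrightarrow> word_val w \<in> carrier S"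
  by (induction w) (auto simp: v_closed)

lemma word_val_closed_support:
  "f \<in> carrier (free_algebra R X) \<Longrightarrow> f w \<noteq> \<zero>\<^bsub>R\<^esub> \<Longrightarrow> word_val w \<in> carrier S"
  by (auto simp only: R.free_algebra_carrier_iff intro: word_val_closed)

text \<open>Words outside the support contribute zero. Enlarging the index set allows elements with
  different supports to be compared termwise.\<close>

lemma eval_hom_eq:
  assumes f: "f \<in> carrier (free_algebra R X)"
    and T: "finite T" "{w. f w \<noteq> \<zero>\<^bsub>R\<^esub>} \<subseteq> T" "T \<subseteq> lists X"
  shows "eval_hom f = (\<Oplus>\<^bsub>S\<^esub>w\<in>T. h (f w) \<otimes>\<^bsub>S\<^esub> word_val w)"
proof -
  have "word_val w \<in> carrier S" if "w \<in> T" for w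
    using that T by (intro word_val_closed) auto
  then show ?thesis
    unfolding eval_hom_def
    using T R.free_algebra_apply_closed[OF f]
    by (intro S.add.finprod_mono_neutral_cong_left) auto
qed

lemma eval_hom_closed:
  "f \<in> carrier (free_algebra R X) \<Longrightarrow> eval_hom f \<in> carrier S"
  unfolding eval_hom_def
  by (intro S.finsum_closed) (auto simp: R.free_algebra_apply_closed word_val_closed_support)

lemma eval_hom_monomial:
  assumes "r \<in> carrier R" "w \<in> lists X"
  shows "eval_hom (R.monomial r w) = h r \<otimes>\<^bsub>S\<^esub> word_val w"
proof -
  have "eval_hom (R.monomial r w) = (\<Oplus>\<^bsub>S\<^esub>u\<in>{w}. h (R.monomial r w u) \<otimes>\<^bsub>S\<^esub> word_val u)"
    using assms by (intro eval_hom_eq R.monomial_closed) (auto simp: R.monomial_def)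
  then show ?thesis
    using assms by (simp add: word_val_closed R.monomial_def)
qed

lemma eval_hom_gen: "x \<in> X \<Longrightarrow> eval_hom (free_gen R x) = v x"
proof -
  assume x: "x \<in> X"
  have "free_gen R x = R.monomial \<one>\<^bsub>R\<^esub> [x]"
    by (auto simp: free_gen_def R.monomial_def)
  then show ?thesis using x by (simp add: eval_hom_monomial v_closed)
qed

lemma eval_hom_add:
  assumes f: "f \<in> carrier (free_algebra R X)" and g: "g \<in> carrier (free_algebra R X)"
  shows "eval_hom (f \<oplus>\<^bsub>free_algebra R X\<^esub> g) = eval_hom f \<oplus>\<^bsub>S\<^esub> eval_hom g"
proof -
  interpret F: ring "free_algebra R X" by (rule R.free_algebra_ring)
  \<comment> \<open>The support of the sum can be smaller than this union because of cancellation,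
    so all three evaluations are written over \<open>T\<close>.\<close>
  define T where "T = {w. f w \<noteq> \<zero>\<^bsub>R\<^esub>} \<union> {w. g w \<noteq> \<zero>\<^bsub>R\<^esub>}"
  have T: "finite T" "T \<subseteq> lists X"
    using f g by (auto simp only: T_def R.free_algebra_carrier_iff finite_Un Un_iff mem_Collect_eq)
  have c: "f w \<in> carrier R" "g w \<in> carrier R" for w
    using f g by (auto simp: R.free_algebra_carrier_iff)
  have wv: "word_val w \<in> carrier S" if "w \<in> T" for w
    using that T by (intro word_val_closed) auto
  have "{w. (f \<oplus>\<^bsub>free_algebra R X\<^esub> g) w \<noteq> \<zero>\<^bsub>R\<^esub>} \<subseteq> T"
    by (auto simp: T_def R.free_algebra_add_apply)
  then have "eval_hom (f \<oplus>\<^bsub>free_algebra R X\<^esub> g) =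
      (\<Oplus>\<^bsub>S\<^esub>w\<in>T. h (f w) \<otimes>\<^bsub>S\<^esub> word_val w \<oplus>\<^bsub>S\<^esub> h (g w) \<otimes>\<^bsub>S\<^esub> word_val w)"
    using T f g c
    by (subst eval_hom_eq[of _ T], simp_all add: R.free_algebra_add_apply)
      (intro S.add.finprod_cong', auto simp: wv S.l_distr)
  also have "\<dots> = (\<Oplus>\<^bsub>S\<^esub>w\<in>T. h (f w) \<otimes>\<^bsub>S\<^esub> word_val w) \<oplus>\<^bsub>S\<^esub> (\<Oplus>\<^bsub>S\<^esub>w\<in>T. h (g w) \<otimes>\<^bsub>S\<^esub> word_val w)"
    using c by (intro S.finsum_addf) (auto simp: wv)
  also have "\<dots> = eval_hom f \<oplus>\<^bsub>S\<^esub> eval_hom g"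
    using T f g by (simp add: eval_hom_eq[of _ T] T_def)
  finally show ?thesis .
qed

lemma eval_hom_scalar_mult:
  assumes r: "r \<in> carrier R" and g: "g \<in> carrier (free_algebra R X)"
  shows "eval_hom (R.monomial r [] \<otimes>\<^bsub>free_algebra R X\<^esub> g) = h r \<otimes>\<^bsub>S\<^esub> eval_hom g"
proof -
  let ?T = "{w. g w \<noteq> \<zero>\<^bsub>R\<^esub>}"
  have T: "finite ?T" "?T \<subseteq> lists X" and c: "\<And>w. g w \<in> carrier R"
    using g by (auto simp: R.free_algebra_carrier_iff)
  note wv = word_val_closed_support[OF g]
  note rg = R.monomial_Nil_mult_apply[OF r g]
  have "eval_hom (R.monomial r [] \<otimes>\<^bsub>free_algebra R X\<^esub> g) =
      (\<Oplus>\<^bsub>S\<^esub>w\<in>?T. h (r \<otimes>\<^bsub>R\<^esub> g w) \<otimes>\<^bsub>S\<^esub> word_val w)"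
    \<comment> \<open>Multiplication by \<open>r\<close> may annihilate coefficients, so the sum is
      taken over the support of \<open>g\<close> instead of that of the product.\<close>
    using T r g by (subst eval_hom_eq[of _ ?T])
      (auto simp: rg intro!: R.free_algebra_mult_closed R.monomial_closed)
  also have "\<dots> = (\<Oplus>\<^bsub>S\<^esub>w\<in>?T. h r \<otimes>\<^bsub>S\<^esub> (h (g w) \<otimes>\<^bsub>S\<^esub> word_val w))"
    using T r c by (intro S.add.finprod_cong') (auto simp: wv S.m_assoc)
  also have "\<dots> = h r \<otimes>\<^bsub>S\<^esub> eval_hom g"
    unfolding eval_hom_def using T r c
    by (intro S.finsum_rdistr[symmetric]) (auto simp: wv)
  finally show ?thesis .
qed

text \<open>Prefixing \<open>x\<close> is a bijection from the support of \<open>g\<close> onto that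
  of the product, so the sum can be reindexed. Letters commute with coefficients in the free
  algebra; \<open>h_central\<close> provides the same in \<open>S\<close>.\<close>

lemma eval_hom_gen_mult:
  assumes x: "x \<in> X" and g: "g \<in> carrier (free_algebra R X)"
  shows "eval_hom (free_gen R x \<otimes>\<^bsub>free_algebra R X\<^esub> g) = v x \<otimes>\<^bsub>S\<^esub> eval_hom g"
proof -
  let ?T = "{w. g w \<noteq> \<zero>\<^bsub>R\<^esub>}"
  let ?xg = "free_gen R x \<otimes>\<^bsub>free_algebra R X\<^esub> g"
  have T: "finite ?T" "?T \<subseteq> lists X" and c: "\<And>w. g w \<in> carrier R"
    using g by (auto simp: R.free_algebra_carrier_iff)
  note wv = word_val_closed_support[OF g]
  note xg = R.free_gen_mult_apply[OF g, of x]
  have supp: "{w. ?xg w \<noteq> \<zero>\<^bsub>R\<^esub>} = (#) x ` ?T"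
  proof -
    have "w \<in> (#) x ` ?T" if "?xg w \<noteq> \<zero>\<^bsub>R\<^esub>" for w
      using that by (cases w) (auto simp: xg split: if_splits)
    then show ?thesis by (auto simp: xg)
  qed
  have "eval_hom ?xg = (\<Oplus>\<^bsub>S\<^esub>w\<in>?T. h (?xg (x # w)) \<otimes>\<^bsub>S\<^esub> word_val (x # w))"
    unfolding eval_hom_def supp using T c x
    by (intro S.add.finprod_reindex) (auto simp: xg wv v_closed)
  also have "\<dots> = (\<Oplus>\<^bsub>S\<^esub>w\<in>?T. v x \<otimes>\<^bsub>S\<^esub> (h (g w) \<otimes>\<^bsub>S\<^esub> word_val w))"
  proof (intro S.add.finprod_cong')
    fix w assume "w \<in> ?T"
    then have w: "word_val w \<in> carrier S" using wv by auto
    then show "h (?xg (x # w)) \<otimes>\<^bsub>S\<^esub> word_val (x # w) = v x \<otimes>\<^bsub>S\<^esub> (h (g w) \<otimes>\<^bsub>S\<^esub> word_val w)"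
      using c x h_central[of "g w" "v x"] by (simp add: xg v_closed flip: S.m_assoc)
  qed (use c x in \<open>auto simp: wv v_closed\<close>)
  also have "\<dots> = v x \<otimes>\<^bsub>S\<^esub> eval_hom g"
    unfolding eval_hom_def using T x c
    by (intro S.finsum_rdistr[symmetric]) (auto simp: wv v_closed)
  finally show ?thesis .
qed

text \<open>Induction on the left factor. The right factor stays arbitrary because, for a product
  \<open>f f'\<close>, the hypothesis on \<open>f\<close> is applied to the right factor
  \<open>f' g\<close>.\<close>

lemma eval_hom_mult:
  assumes f: "f \<in> carrier (free_algebra R X)" and g: "g \<in> carrier (free_algebra R X)"
  shows "eval_hom (f \<otimes>\<^bsub>free_algebra R X\<^esub> g) = eval_hom f \<otimes>\<^bsub>S\<^esub> eval_hom g"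
  using f g
proof (induction f arbitrary: g rule: R.free_algebra_induct)
  case (scalar r)
  then show ?case by (simp add: eval_hom_scalar_mult eval_hom_monomial)
next
  case (gen x)
  then show ?case by (simp add: eval_hom_gen_mult eval_hom_gen)
next
  case (add f f' g)
  interpret F: ring "free_algebra R X" by (rule R.free_algebra_ring)
  show ?case using add
    by (simp add: F.l_distr S.l_distr eval_hom_add eval_hom_closed)
next
  case (mult f f' g)
  interpret F: ring "free_algebra R X" by (rule R.free_algebra_ring)
  show ?case using mult
    by (simp add: F.m_assoc S.m_assoc eval_hom_closed)
qed

lemma eval_hom_ring_hom: "eval_hom \<in> ring_hom (free_algebra R X) S"
proof (rule ring_hom_memI)
  have "\<one>\<^bsub>free_algebra R X\<^esub> = R.monomial \<one>\<^bsub>R\<^esub> []"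
    by (simp add: free_algebra_def R.monomial_def)
  then show "eval_hom \<one>\<^bsub>free_algebra R X\<^esub> = \<one>\<^bsub>S\<^esub>"
    by (simp add: eval_hom_monomial)
qed (auto simp: eval_hom_closed eval_hom_add eval_hom_mult)

end

section \<open>Homomorphisms out of a quotient by an ideal\<close>

lemma (in ring) genideal_subset_kernel:
  assumes h: "ring_hom_ring R S h" and T: "T \<subseteq> carrier R" "\<And>x. x \<in> T \<Longrightarrow> h x = \<zero>\<^bsub>S\<^esub>"
  shows "genideal R T \<subseteq> a_kernel R S h"
proof (rule genideal_minimal)
  interpret h: ring_hom_ring R S h by fact
  show "ideal (a_kernel R S h) R" by (rule h.kernel_is_ideal)
  show "T \<subseteq> a_kernel R S h" using T unfolding a_kernel_def' by blast
qed

lemma (in ideal) quotient_lift: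
  assumes h: "ring_hom_ring R S h" and ker: "I \<subseteq> a_kernel R S h"
  shows "\<exists>k \<in> ring_hom (R Quot I) S. \<forall>x \<in> carrier R. k (I +> x) = h x"
proof -
  interpret h: ring_hom_ring R S h by fact
  \<comment> \<open>\<open>h\<close> is constant on each coset of \<open>I\<close>, because elements
    of \<open>I\<close> are sent to zero; \<open>k\<close> picks out that single value.\<close>
  define k where "k X = the_elem (h ` X)" for X
  have k: "k (I +> x) = h x" if x: "x \<in> carrier R" for x
  proof -
    have "h y = h x" if y: "y \<in> I +> x" for y
    proof -
      obtain i where i: "i \<in> I" "y = i \<oplus> x" using y unfolding a_r_coset_def' by blast
      then have "i \<in> carrier R" "h i = \<zero>\<^bsub>S\<^esub>" using ker unfolding a_kernel_def' by blast+
      then show ?thesis using i x by simp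
    qed
    moreover have "x \<in> I +> x" using x by (rule a_rcos_self)
    ultimately have "h ` (I +> x) = {h x}" by blast
    then show ?thesis by (simp add: k_def)
  qed
  have "k \<in> ring_hom (R Quot I) S"
  proof (rule ring_hom_memI)
    show "k \<one>\<^bsub>R Quot I\<^esub> = \<one>\<^bsub>S\<^esub>" by (simp add: FactRing_def k)
  next
    fix Y Z assume "Y \<in> carrier (R Quot I)" "Z \<in> carrier (R Quot I)"
    then obtain y z where "y \<in> carrier R" "z \<in> carrier R" "Y = I +> y" "Z = I +> z"
      by (auto simp: FactRing_simps)
    then show "k Y \<in> carrier S" "k (Y \<otimes>\<^bsub>R Quot I\<^esub> Z) = k Y \<otimes>\<^bsub>S\<^esub> k Z"
      "k (Y \<oplus>\<^bsub>R Quot I\<^esub> Z) = k Y \<oplus>\<^bsub>S\<^esub> k Z"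
      by (simp_all add: k FactRing_def rcoset_mult_add a_rcos_sum)
  qed
  then show ?thesis using k by blast
qed

context ring
begin

text \<open>Followed by the projection to a quotient, this gives the structure map from the
  coefficients.\<close>

lemma monomial_ring_hom: "(\<lambda>r. monomial r []) \<in> ring_hom R (free_algebra R X)"
proof (rule ring_hom_memI)
  fix r s assume "r \<in> carrier R" "s \<in> carrier R"
  then show "monomial r [] \<in> carrier (free_algebra R X)"
    "monomial (r \<otimes> s) [] = monomial r [] \<otimes>\<^bsub>free_algebra R X\<^esub> monomial s []"
    "monomial (r \<oplus> s) [] = monomial r [] \<oplus>\<^bsub>free_algebra R X\<^esub> monomial s []"
    using monomial_Nil_mult_apply[OF _ monomial_closed[of s "[]" X], of r]
    by (auto simp: monomial_closed fun_eq_iff free_algebra_add_apply) (auto simp: monomial_def)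
qed (auto simp: monomial_def free_algebra_def)

lemma mult_monomial_Nil_apply:
  assumes "r \<in> carrier R" "g \<in> carrier (free_algebra R X)"
  shows "(g \<otimes>\<^bsub>free_algebra R X\<^esub> monomial r []) w = g w \<otimes> r"
proof -
  have "(\<Oplus>i\<in>{..length w}. g (take i w) \<otimes> monomial r [] (drop i w))
      = (\<Oplus>i\<in>{..length w}. if length w = i then g (take i w) \<otimes> r else \<zero>)"
    using assms by (intro add.finprod_cong') (auto simp: monomial_def free_algebra_carrier_iff)
  also have "\<dots> = g (take (length w) w) \<otimes> r"
    using assms by (intro add.finprod_singleton) (auto simp: free_algebra_carrier_iff)
  finally show ?thesis by (simp add: free_algebra_def)
qed

end

lemma (in cring) monomial_Nil_central:
  assumes "r \<in> carrier R" "g \<in> carrier (free_algebra R X)"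
  shows "monomial r [] \<otimes>\<^bsub>free_algebra R X\<^esub> g = g \<otimes>\<^bsub>free_algebra R X\<^esub> monomial r []"
  using assms
  by (auto simp: fun_eq_iff monomial_Nil_mult_apply mult_monomial_Nil_apply free_algebra_apply_closed m_comm)


section \<open>The centre of a ring and the Frobenius map\<close>

context ring
begin

definition centre :: "'a set" where
  "centre = {z \<in> carrier R. \<forall>x \<in> carrier R. z \<otimes> x = x \<otimes> z}"

lemma centre_carrier: "z \<in> centre \<Longrightarrow> z \<in> carrier R"
  by (simp add: centre_def)

lemma centre_comm: "z \<in> centre \<Longrightarrow> x \<in> carrier R \<Longrightarrow> z \<otimes> x = x \<otimes> z"
  by (simp add: centre_def)

lemma centreI:
  "z \<in> carrier R \<Longrightarrow> (\<And>x. x \<in> carrier R \<Longrightarrow> z \<otimes> x = x \<otimes> z) \<Longrightarrow> z \<in> centre"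
  by (simp add: centre_def)

lemma zero_centre: "\<zero> \<in> centre" and one_centre: "\<one> \<in> centre"
  by (simp_all add: centre_def)

lemma add_centre: "y \<in> centre \<Longrightarrow> z \<in> centre \<Longrightarrow> y \<oplus> z \<in> centre"
  by (rule centreI) (simp_all add: centre_carrier l_distr r_distr centre_comm)

lemma minus_centre: "z \<in> centre \<Longrightarrow> \<ominus> z \<in> centre"
  by (rule centreI) (simp_all add: centre_carrier l_minus r_minus centre_comm)

lemma mult_centre:
  assumes y: "y \<in> centre" and z: "z \<in> centre"
  shows "y \<otimes> z \<in> centre"
proof -
  have "y \<otimes> z \<otimes> x = x \<otimes> (y \<otimes> z)" if x: "x \<in> carrier R" for x
  proof -
    have "y \<otimes> z \<otimes> x = y \<otimes> (x \<otimes> z)"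
      using x y z by (simp add: m_assoc centre_carrier centre_comm[OF z])
    also have "\<dots> = x \<otimes> y \<otimes> z"
      using x y z by (simp add: centre_carrier centre_comm[OF y x] flip: m_assoc)
    finally show ?thesis using x y z by (simp add: m_assoc centre_carrier)
  qed
  then show ?thesis using y z by (intro centreI) (auto simp: centre_carrier)
qed

lemma pow_centre: "z \<in> centre \<Longrightarrow> z [^] (k::nat) \<in> centre"
  by (induction k) (simp_all add: one_centre mult_centre)

lemma finsum_centre:
  assumes "finite S" "\<And>i. i \<in> S \<Longrightarrow> f i \<in> centre"
  shows "finsum R f S \<in> centre"
  using assms
proof (induction S rule: finite_induct)
  case (insert i S)
  then have "finsum R f (insert i S) = f i \<oplus> finsum R f S"
    by (intro finsum_insert) (auto simp: centre_carrier)
  then show ?case using insert by (simp add: add_centre)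
qed (simp add: zero_centre)

text \<open>Stated for a commuting pair because the ambient ring contains anticommuting elements.
  The induction is Pascal's rule: multiplying by \<open>x\<close> shifts the index of
  \<open>t\<close>, multiplying by \<open>y\<close> keeps it.\<close>

lemma binomial_pow:
  assumes x: "x \<in> carrier R" and y: "y \<in> carrier R" and xy: "x \<otimes> y = y \<otimes> x"
  shows "(x \<oplus> y) [^] n = (\<Oplus>k\<in>{..n}. add_pow R (n choose k) (x [^] k \<otimes> y [^] (n - k)))"
proof (induction n)
  case 0
  then show ?case by simp
next
  case (Suc n)
  define t where "t k = x [^] k \<otimes> y [^] (Suc n - k)" for k :: nat
  have t: "t k \<in> carrier R" for k using x y by (simp add: t_def)
  let ?S = "\<Oplus>k\<in>{..n}. add_pow R (n choose k) (x [^] k \<otimes> y [^] (n - k))"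
  have yx: "y \<otimes> x [^] k = x [^] k \<otimes> y" for k :: nat
    using x y
    by (induction k) (simp_all add: m_assoc, simp_all add: xy flip: m_assoc)
  have "x \<otimes> ?S = (\<Oplus>k\<in>{..n}. x \<otimes> (add_pow R (n choose k) (x [^] k \<otimes> y [^] (n - k))))"
    using x y by (intro finsum_rdistr) auto
  also have "\<dots> = (\<Oplus>k\<in>{..n}. add_pow R (n choose k) (t (Suc k)))"
  proof (intro add.finprod_cong')
    fix k assume "k \<in> {..n}"
    have "x \<otimes> (x [^] k \<otimes> y [^] (n - k)) = t (Suc k)"
      using x y nat_pow_Suc2[OF x, of k] by (simp add: t_def flip: m_assoc del: nat_pow_Suc)
    then show "x \<otimes> add_pow R (n choose k) (x [^] k \<otimes> y [^] (n - k)) = add_pow R (n choose k) (t (Suc k))"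
      using x y by (simp add: add_pow_rdistr)
  qed (use t in auto)
  finally have 1: "x \<otimes> ?S = (\<Oplus>k\<in>{..n}. add_pow R (n choose k) (t (Suc k)))" .
  have "y \<otimes> ?S = (\<Oplus>k\<in>{..n}. y \<otimes> (add_pow R (n choose k) (x [^] k \<otimes> y [^] (n - k))))"
    using x y by (intro finsum_rdistr) auto
  also have "\<dots> = (\<Oplus>k\<in>{..n}. add_pow R (n choose k) (t k))"
  proof (intro add.finprod_cong')
    fix k assume "k \<in> {..n}"
    then have "y [^] (Suc n - k) = y \<otimes> y [^] (n - k)"
      using nat_pow_Suc2[OF y, of "n - k"] by (simp add: Suc_diff_le del: nat_pow_Suc)
    then have "y \<otimes> (x [^] k \<otimes> y [^] (n - k)) = t k"
      using x y by (simp add: t_def yx flip: m_assoc)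
    then show "y \<otimes> (add_pow R (n choose k) (x [^] k \<otimes> y [^] (n - k))) = add_pow R (n choose k) (t k)"
      using x y by (simp add: add_pow_rdistr)
  qed (use t in auto)
  \<comment> \<open>The added term vanishes since \<open>n choose Suc n\<close> is zero. Splitting
    off \<open>t 0\<close> then leaves a sum indexed like that in \<open>1\<close>.\<close>
  also have "\<dots> = (\<Oplus>k\<in>{..Suc n}. add_pow R (n choose k) (t k))"
    using t by (subst finsum_Suc) (auto simp: binomial_eq_0)
  also have "\<dots> = (\<Oplus>k\<in>{..n}. add_pow R (n choose Suc k) (t (Suc k))) \<oplus> t 0"
    using t by (subst finsum_Suc2) auto
  finally have 2: "y \<otimes> ?S = (\<Oplus>k\<in>{..n}. add_pow R (n choose Suc k) (t (Suc k))) \<oplus> t 0" .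
  have S: "?S \<in> carrier R" using x y by (intro finsum_closed) auto
  have "(x \<oplus> y) [^] Suc n = x \<otimes> ?S \<oplus> y \<otimes> ?S"
    using x y S Suc.IH nat_pow_Suc2[of "x \<oplus> y" n] by (simp add: l_distr del: nat_pow_Suc)
  also have "\<dots> = (\<Oplus>k\<in>{..n}. add_pow R (n choose k) (t (Suc k)) \<oplus> add_pow R (n choose Suc k) (t (Suc k))) \<oplus> t 0"
    unfolding 1 2 using t by (simp add: finsum_addf a_assoc)
  also have "\<dots> = (\<Oplus>k\<in>{..n}. add_pow R (Suc n choose Suc k) (t (Suc k))) \<oplus> t 0"
    using t by (simp add: add.nat_pow_mult)
  also have "\<dots> = (\<Oplus>k\<in>{..Suc n}. add_pow R (Suc n choose k) (t k))"
    using t by (subst finsum_Suc2) auto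
  finally show ?case by (simp add: t_def)
qed

text \<open>Any multiple of \<open>x\<close> is the corresponding multiple of the unit times
  \<open>x\<close>, so a relation on the unit is enough.\<close>

lemma add_pow_eq_zero:
  assumes "add_pow R p \<one> = \<zero>" "p dvd m" "x \<in> carrier R"
  shows "add_pow R (m::nat) x = \<zero>"
proof -
  obtain q where "m = p * q" using assms(2) by blast
  then have "add_pow R m x = add_pow R q (add_pow R p (\<one> \<otimes> x))"
    using assms by (simp add: add.nat_pow_pow)
  also have "add_pow R p (\<one> \<otimes> x) = add_pow R p \<one> \<otimes> x"
    using assms by (intro add_pow_ldistr[symmetric]) auto
  finally show ?thesis using assms by simp
qed

end

section \<open>The Frobenius map on central elements\<close>

locale prime_char_ring = ring +
  fixes p :: nat
  assumes prime_p: "prime p" and char_p: "add_pow R p \<one> = \<zero>"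
begin

text \<open>All binomial coefficients strictly between the two ends are divisible by the prime
  \<open>p\<close>.\<close>

lemma pow_p_add:
  assumes "y \<in> centre" "z \<in> centre"
  shows "(y \<oplus> z) [^] p = y [^] p \<oplus> z [^] p"
proof -
  have c: "y \<in> carrier R" "z \<in> carrier R" "y \<otimes> z = z \<otimes> y"
    using assms by (auto simp: centre_carrier centre_comm)
  have p0: "p > 0" using prime_p by (rule prime_gt_0_nat)
  have "(y \<oplus> z) [^] p = (\<Oplus>k\<in>{..p}. add_pow R (p choose k) (y [^] k \<otimes> z [^] (p - k)))"
    using c by (rule binomial_pow)
  also have "\<dots> = (\<Oplus>k\<in>{0, p}. add_pow R (p choose k) (y [^] k \<otimes> z [^] (p - k)))"
  proof (rule add.finprod_mono_neutral_cong_right)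
    fix k assume "k \<in> {..p} - {0, p}"
    then have "p dvd p choose k"
      using prime_p by (intro dvd_choose_prime) auto
    then show "add_pow R (p choose k) (y [^] k \<otimes> z [^] (p - k)) = \<zero>"
      using c by (intro add_pow_eq_zero[OF char_p]) auto
  qed (use c in auto)
  also have "\<dots> = y [^] p \<oplus> z [^] p"
    using c p0 by (simp add: a_comm)
  finally show ?thesis .
qed

lemma frobenius_add:
  assumes "y \<in> centre" "z \<in> centre"
  shows "(y \<oplus> z) [^] (p ^ j) = y [^] (p ^ j) \<oplus> z [^] (p ^ j)"
proof (induction j)
  case 0
  then show ?case using assms by (simp add: centre_carrier)
next
  case (Suc j)
  have "(y \<oplus> z) [^] (p ^ Suc j) = ((y \<oplus> z) [^] (p ^ j)) [^] p"
    using assms by (simp add: nat_pow_pow centre_carrier mult.commute)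
  also have "\<dots> = (y [^] (p ^ j)) [^] p \<oplus> (z [^] (p ^ j)) [^] p"
    unfolding Suc using assms by (intro pow_p_add pow_centre)
  finally show ?case
    using assms by (simp add: nat_pow_pow centre_carrier mult.commute)
qed

lemma frobenius_zero: "\<zero> [^] (p ^ j) = \<zero>"
  using prime_p by (simp add: nat_pow_zero prime_gt_0_nat)

text \<open>Additivity applied to \<open>\<ominus> z \<oplus> z\<close> makes the left side an
  additive inverse of the power of \<open>z\<close>, without regard to the parity of
  \<open>p\<close>.\<close>

lemma frobenius_minus:
  assumes "z \<in> centre"
  shows "(\<ominus> z) [^] (p ^ j) = \<ominus> (z [^] (p ^ j))"
proof -
  have "(\<ominus> z) [^] (p ^ j) \<oplus> z [^] (p ^ j) = (\<ominus> z \<oplus> z) [^] (p ^ j)"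
    using assms by (intro frobenius_add[symmetric] minus_centre)
  also have "\<dots> = \<zero>" using assms by (simp add: l_neg centre_carrier frobenius_zero)
  finally show ?thesis
    using assms by (intro minus_equality[symmetric]) (auto simp: centre_carrier)
qed

lemma frobenius_mult:
  assumes "y \<in> centre" "z \<in> carrier R"
  shows "(y \<otimes> z) [^] (k::nat) = y [^] k \<otimes> z [^] k"
  using assms by (intro pow_mult_distrib) (simp_all add: centre_carrier centre_comm[of y z])

lemma frobenius_finsum:
  assumes "finite S" "\<And>i. i \<in> S \<Longrightarrow> f i \<in> centre"
  shows "(\<Oplus>i\<in>S. f i) [^] (p ^ j) = (\<Oplus>i\<in>S. f i [^] (p ^ j))"
  using assms
proof (induction S rule: finite_induct)
  case (insert i S)
  then have "finsum R f (insert i S) = f i \<oplus> finsum R f S"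
    by (intro finsum_insert) (auto simp: centre_carrier)
  moreover have "finsum R (\<lambda>i. f i [^] (p ^ j)) (insert i S) =
      f i [^] (p ^ j) \<oplus> finsum R (\<lambda>i. f i [^] (p ^ j)) S"
    using insert by (intro finsum_insert) (auto simp: centre_carrier)
  moreover have "(f i \<oplus> finsum R f S) [^] (p ^ j) = f i [^] (p ^ j) \<oplus> finsum R f S [^] (p ^ j)"
    using insert by (intro frobenius_add finsum_centre) auto
  ultimately show ?case using insert by simp
qed (simp add: frobenius_zero)

end

section \<open>Paths in the labelled digraph\<close>

lemma pcas_snoc: "pcas u (es @ [e]) v \<longleftrightarrow> pcas u es (fst e) \<and> snd e = v"
  by (induction es arbitrary: u) auto

text \<open>The lower bound on the visited vertices strengthens the induction: it puts the source of
  the first arc below everything that follows.\<close>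

lemma pawalk_verts_increasing:
  fixes u :: nat
  assumes "pcas u es v" "\<forall>e \<in> set es. fst e < snd e"
  shows "sorted_wrt (<) (pawalk_verts u es) \<and> (\<forall>x \<in> set (pawalk_verts u es). u \<le> x)"
  using assms
proof (induction es arbitrary: u)
  case (Cons e es)
  then have "sorted_wrt (<) (pawalk_verts (snd e) es)" "\<forall>x \<in> set (pawalk_verts (snd e) es). snd e \<le> x"
    "fst e = u" "fst e < snd e"
    by auto
  then show ?case by fastforce
qed simp

lemma pverts_K: "pverts (K p n) = insert 1 ((\<lambda>a. 2 * p ^ a) ` {0..n})"
  by (simp add: K_def Let_def)

lemma finite_pverts_K: "finite (pverts (K p n))"
  by (simp add: pverts_K)

lemma parcs_K: "parcs (K p n) = {(u, v). u \<in> pverts (K p n) \<and> v \<in> pverts (K p n) \<and> u < v}"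
  by (simp add: K_def Let_def)

text \<open>An \<open>apath\<close> must not repeat vertices. Here this is automatic, because every
  arc leads to a larger vertex.\<close>

lemma mem_paths_iff:
  "es \<in> paths p n u v \<longleftrightarrow> u \<in> pverts (K p n) \<and> set es \<subseteq> parcs (K p n) \<and> pcas u es v"
proof -
  have "distinct (pawalk_verts u es)" if "set es \<subseteq> parcs (K p n)" "pcas u es v"
  proof -
    have "sorted_wrt (<) (pawalk_verts u es)"
      using that by (intro pawalk_verts_increasing[THEN conjunct1]) (auto simp: parcs_K)
    then show ?thesis by (simp add: strict_sorted_iff)
  qed
  then show ?thesis
    by (auto simp: paths_def pre_digraph.apath_def pre_digraph.awalk_def
        cas_with_proj_eq awalk_verts_with_proj_eq)
qed

lemma pcas_le:
  fixes u :: nat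
  assumes "pcas u es v" "\<forall>e \<in> set es. fst e < snd e"
  shows "u \<le> v \<and> (es \<noteq> [] \<longrightarrow> u < v)"
  using assms by (induction es arbitrary: u) fastforce+

lemma paths_le: "es \<in> paths p n u v \<Longrightarrow> u \<le> v \<and> (es \<noteq> [] \<longrightarrow> u < v)"
  by (rule pcas_le) (auto simp: mem_paths_iff parcs_K)

lemma paths_refl: "u \<in> pverts (K p n) \<Longrightarrow> paths p n u u = {[]}"
  using paths_le[of _ p n u u] by (auto simp: mem_paths_iff)

text \<open>The last edge is the right one to remove: the recursion of the antipode pairs the value
  for a smaller index, a sum over paths from the same start, with the label of one edge into the
  end. The case \<open>w = u\<close> accounts for the path with a single edge.\<close>

lemma paths_last_edge:
  assumes u: "u \<in> pverts (K p n)" and v: "v \<in> pverts (K p n)" and uv: "u < v"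
  shows "paths p n u v =
    (\<Union>w \<in> {w \<in> pverts (K p n). u \<le> w \<and> w < v}. (\<lambda>es. es @ [(w, v)]) ` paths p n u w)"
proof (intro subset_antisym subsetI)
  fix es assume es: "es \<in> paths p n u v"
  show "es \<in> (\<Union>w \<in> {w \<in> pverts (K p n). u \<le> w \<and> w < v}. (\<lambda>es. es @ [(w, v)]) ` paths p n u w)"
  proof (cases es rule: rev_cases)
    case Nil
    then show ?thesis using es uv by (simp add: mem_paths_iff)
  next
    case (snoc es' e)
    then have e: "e = (fst e, v)" "fst e \<in> pverts (K p n)" "fst e < v"
      and es': "es' \<in> paths p n u (fst e)"
      using es by (auto simp: mem_paths_iff pcas_snoc parcs_K)
    then show ?thesis using paths_le[OF es'] snoc by auto
  qed
next
  fix es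
  assume "es \<in> (\<Union>w \<in> {w \<in> pverts (K p n). u \<le> w \<and> w < v}. (\<lambda>es. es @ [(w, v)]) ` paths p n u w)"
  then show "es \<in> paths p n u v"
    using v by (auto simp: mem_paths_iff pcas_snoc parcs_K)
qed

text \<open>Strong induction on the end vertex through \<open>paths_last_edge\<close>; unless both
  ends are vertices there are no paths at all.\<close>

lemma finite_paths: "finite (paths p n u v)"
proof (cases "u \<in> pverts (K p n) \<and> v \<in> pverts (K p n)")
  case True
  then show ?thesis
  proof (induction v rule: less_induct)
    case (less v)
    consider "u < v" | "u = v" | "v < u" by linarith
    then show ?case
    proof cases
      case 1
      then show ?thesis
        using less finite_pverts_K[of p n] by (simp add: paths_last_edge)
    next
      case 2
      then show ?thesis using less.prems by (simp add: paths_refl)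
    next
      case 3
      then have "paths p n u v = {}" using paths_le[of _ p n u v] by fastforce
      then show ?thesis by simp
    qed
  qed
next
  case False
  have "u \<in> pverts (K p n) \<and> v \<in> pverts (K p n)" if "es \<in> paths p n u v" for es
    using that by (cases es rule: rev_cases) (auto simp: mem_paths_iff pcas_snoc parcs_K)
  then have "paths p n u v = {}" using False by blast
  then show ?thesis by simp
qed

lemma vexp_eq: "1 < p \<Longrightarrow> vexp p (2 * p ^ a) = a"
  unfolding vexp_def by (rule the_equality) auto

lemma edge_label_xi: "1 < p \<Longrightarrow>
    edge_label p n (2 * p ^ a, 2 * p ^ b) = \<xi> p n (b - a) [^]\<^bsub>Adual p n\<^esub> (p ^ a)"
  by (simp add: edge_label_def vexp_eq)

lemma edge_label_tau: "1 < p \<Longrightarrow> edge_label p n (1, 2 * p ^ b) = \<tau> p n b"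
  by (simp add: edge_label_def vexp_eq)

section \<open>Generators and relations of the quotient Hopf algebra\<close>

definition (in ring) anticommutant :: "'a set \<Rightarrow> 'a set" where
  "anticommutant S = {x \<in> carrier R. \<forall>y \<in> S. x \<otimes> y = \<ominus> (y \<otimes> x)}"

context ring
begin

lemma anticommutant_carrier: "x \<in> anticommutant S \<Longrightarrow> x \<in> carrier R"
  by (simp add: anticommutant_def)

lemma anticommutantD: "x \<in> anticommutant S \<Longrightarrow> y \<in> S \<Longrightarrow> x \<otimes> y = \<ominus> (y \<otimes> x)"
  by (simp add: anticommutant_def)

lemma anticommutant_zero: "S \<subseteq> carrier R \<Longrightarrow> \<zero> \<in> anticommutant S"
  by (auto simp: anticommutant_def)

lemma anticommutant_add:
  assumes S: "S \<subseteq> carrier R" and x: "x \<in> anticommutant S" and y: "y \<in> anticommutant S"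
  shows "x \<oplus> y \<in> anticommutant S"
proof -
  have "(x \<oplus> y) \<otimes> s = \<ominus> (s \<otimes> (x \<oplus> y))" if s: "s \<in> S" for s
  proof -
    have c: "s \<in> carrier R" "x \<in> carrier R" "y \<in> carrier R"
      using S s x y by (auto simp: anticommutant_carrier)
    have "(x \<oplus> y) \<otimes> s = \<ominus> (s \<otimes> x) \<oplus> \<ominus> (s \<otimes> y)"
      using c anticommutantD[OF x s] anticommutantD[OF y s] by (simp add: l_distr)
    also have "\<dots> = \<ominus> (s \<otimes> (x \<oplus> y))"
      using c by (simp add: r_distr minus_add)
    finally show ?thesis .
  qed
  then show ?thesis using x y by (simp add: anticommutant_def)
qed

lemma anticommutant_minus:
  assumes S: "S \<subseteq> carrier R" and x: "x \<in> anticommutant S"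
  shows "\<ominus> x \<in> anticommutant S"
proof -
  have "\<ominus> x \<otimes> s = \<ominus> (s \<otimes> \<ominus> x)" if s: "s \<in> S" for s
  proof -
    have "s \<in> carrier R" "x \<in> carrier R"
      using S s x by (auto simp: anticommutant_carrier)
    then show ?thesis using anticommutantD[OF x s] by (simp add: l_minus r_minus)
  qed
  then show ?thesis using x by (simp add: anticommutant_def)
qed

lemma anticommutant_centre_mult:
  assumes S: "S \<subseteq> carrier R" and z: "z \<in> centre" and x: "x \<in> anticommutant S"
  shows "z \<otimes> x \<in> anticommutant S"
proof -
  have "z \<otimes> x \<otimes> s = \<ominus> (s \<otimes> (z \<otimes> x))" if s: "s \<in> S" for s
  proof -
    have c: "s \<in> carrier R" "x \<in> carrier R" "z \<in> carrier R"
      using S s x z by (auto simp: anticommutant_carrier centre_carrier)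
    have "z \<otimes> x \<otimes> s = z \<otimes> \<ominus> (s \<otimes> x)"
      using c anticommutantD[OF x s] by (simp add: m_assoc)
    also have "\<dots> = \<ominus> (z \<otimes> s \<otimes> x)" using c by (simp add: r_minus m_assoc)
    also have "\<dots> = \<ominus> (s \<otimes> (z \<otimes> x))" using c by (simp add: centre_comm[OF z] m_assoc)
    finally show ?thesis .
  qed
  then show ?thesis using x z by (simp add: anticommutant_def centre_carrier)
qed

lemma anticommutant_finsum:
  assumes S: "S \<subseteq> carrier R" and T: "finite T" "\<And>i. i \<in> T \<Longrightarrow> f i \<in> anticommutant S"
  shows "finsum R f T \<in> anticommutant S"
  using T
proof (induction T rule: finite_induct)
  case (insert i T)
  then have "finsum R f (insert i T) = f i \<oplus> finsum R f T"
    by (intro finsum_insert) (auto intro: anticommutant_carrier)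
  then show ?case using insert S by (simp add: anticommutant_add)
qed (simp add: S anticommutant_zero)

lemma finsum_minus:
  assumes "finite T" "\<And>i. i \<in> T \<Longrightarrow> f i \<in> carrier R"
  shows "(\<Oplus>i\<in>T. \<ominus> f i) = \<ominus> (\<Oplus>i\<in>T. f i)"
  using assms
proof (induction T rule: finite_induct)
  case (insert i T)
  have "finsum R f (insert i T) = f i \<oplus> finsum R f T"
    using insert by (intro finsum_insert) auto
  moreover have "finsum R (\<lambda>i. \<ominus> f i) (insert i T) = \<ominus> f i \<oplus> finsum R (\<lambda>i. \<ominus> f i) T"
    using insert by (intro finsum_insert) auto
  moreover have "finsum R f T \<in> carrier R" using insert by (intro finsum_closed) auto
  ultimately show ?case using insert by (simp add: minus_add)
qed simp

end

section \<open>The quotient algebra: generators, characteristic, commutation rules and universal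
  property\<close>

locale steenrod_quotient =
  fixes p n :: nat
  assumes prime: "prime p" and odd: "odd p"
begin

abbreviation Zp where "Zp \<equiv> residue_ring (int p)"
abbreviation F where "F \<equiv> free_alg p n"
abbreviation A where "A \<equiv> Adual p n"

lemma p_gt_1: "1 < p"
  using prime by (rule prime_gt_1_nat)

sublocale Zp: cring Zp
  using p_gt_1 by (intro residues.cring) (simp add: residues_def)

sublocale F: ring F
  by (rule Zp.free_algebra_ring)

lemma fgen_closed: "a \<in> gens n \<Longrightarrow> fgen p a \<in> carrier F"
  by (rule Zp.free_gen_closed)

lemma relations_closed: "relations p n \<subseteq> carrier F"
proof -
  have "Xi i \<in> gens n" if "i \<in> {1..n}" for i using that by (simp add: gens_def)
  moreover have "Tau i \<in> gens n" if "i \<in> {0..n}" for i using that by (simp add: gens_def)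
  ultimately show ?thesis
    unfolding relations_def
    by (auto intro!: F.minus_closed F.m_closed F.nat_pow_closed F.add.int_pow_closed fgen_closed)
qed

sublocale I: ideal "rel_ideal p n" F
  unfolding rel_ideal_def by (rule F.genideal_ideal[OF relations_closed])

sublocale A: ring A
  unfolding Adual_def by (rule I.quotient_is_ring)

definition proj where "proj f = rel_ideal p n +>\<^bsub>F\<^esub> f"

sublocale proj: ring_hom_ring F A proj
  using I.rcos_ring_hom_ring unfolding Adual_def proj_def[abs_def] .

lemma proj_surj: "x \<in> carrier A \<Longrightarrow> \<exists>f \<in> carrier F. x = proj f"
  by (auto simp: Adual_def proj_def FactRing_def A_RCOSETS_def')

lemma proj_relation: "r \<in> relations p n \<Longrightarrow> proj r = \<zero>\<^bsub>A\<^esub>"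
proof -
  assume "r \<in> relations p n"
  then have "r \<in> rel_ideal p n"
    unfolding rel_ideal_def using F.genideal_self[OF relations_closed] by blast
  then show ?thesis
    using F.a_rcos_zero[OF I.ideal_axioms] by (simp add: proj_def Adual_def FactRing_def)
qed

text \<open>Treats both families of generators uniformly. The element \<open>\<xi> p n 0\<close> is
  the unit and not among them.\<close>

definition agen where "agen a = proj (fgen p a)"

lemma agen_closed: "a \<in> gens n \<Longrightarrow> agen a \<in> carrier A"
  by (simp add: agen_def fgen_closed)

lemma xi_eq_agen: "1 \<le> i \<Longrightarrow> \<xi> p n i = agen (Xi i)"
  by (simp add: \<xi>_def agen_def proj_def)

lemma tau_eq_agen: "\<tau> p n i = agen (Tau i)"
  by (simp add: \<tau>_def agen_def proj_def)

lemma Xi_gens: "1 \<le> i \<Longrightarrow> i \<le> n \<Longrightarrow> Xi i \<in> gens n"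
  and Tau_gens: "i \<le> n \<Longrightarrow> Tau i \<in> gens n"
  by (auto simp: gens_def)

lemma xi_closed: "i \<le> n \<Longrightarrow> \<xi> p n i \<in> carrier A"
  by (cases "i = 0") (auto simp: xi_eq_agen Xi_gens agen_closed, simp add: \<xi>_def)

lemma tau_closed: "i \<le> n \<Longrightarrow> \<tau> p n i \<in> carrier A"
  by (simp add: tau_eq_agen agen_closed Tau_gens)

text \<open>The structure map from the prime field to the algebra.\<close>

definition scalar where "scalar r = proj (Zp.monomial r [])"

lemma scalar_ring_hom: "scalar \<in> ring_hom Zp A"
  using ring_hom_trans[OF Zp.monomial_ring_hom proj.homh] by (simp add: scalar_def[abs_def] comp_def)

sublocale scalar: ring_hom_ring Zp A scalar
  by (intro ring_hom_ringI2 Zp.ring_axioms A.ring_axioms scalar_ring_hom)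

lemma scalar_eq_add_pow: "k < p \<Longrightarrow> scalar (int k) = add_pow A k \<one>\<^bsub>A\<^esub>"
proof (induction k)
  case 0
  then show ?case using scalar.hom_zero by (simp add: residue_ring_def)
next
  case (Suc k)
  \<comment> \<open>No reduction modulo \<open>p\<close> takes place, because \<open>Suc k\<close>
    is still below \<open>p\<close>.\<close>
  have "int (Suc k) = int k \<oplus>\<^bsub>Zp\<^esub> \<one>\<^bsub>Zp\<^esub>"
    using Suc.prems by (simp add: residue_ring_def)
  then have "scalar (int (Suc k)) = scalar (int k \<oplus>\<^bsub>Zp\<^esub> \<one>\<^bsub>Zp\<^esub>)" by (rule arg_cong)
  also have "\<dots> = scalar (int k) \<oplus>\<^bsub>A\<^esub> scalar \<one>\<^bsub>Zp\<^esub>"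
    using Suc.prems by (intro scalar.hom_add) (simp_all add: residue_ring_def)
  also have "\<dots> = add_pow A k \<one>\<^bsub>A\<^esub> \<oplus>\<^bsub>A\<^esub> \<one>\<^bsub>A\<^esub>"
    using Suc by (simp only: scalar.hom_one)
  finally show ?case by (simp only: A.add.nat_pow_Suc)
qed

text \<open>Adding the unit once more to the scalar \<open>p - 1\<close> wraps around to zero in the
  prime field.\<close>

lemma char_A: "add_pow A p \<one>\<^bsub>A\<^esub> = \<zero>\<^bsub>A\<^esub>"
proof -
  have c: "int (p - 1) \<in> carrier Zp" using p_gt_1 by (simp add: residue_ring_def)
  have s: "scalar (int (p - 1)) = add_pow A (p - 1) \<one>\<^bsub>A\<^esub>"
    using p_gt_1 by (intro scalar_eq_add_pow) simp
  have "add_pow A (Suc (p - 1)) \<one>\<^bsub>A\<^esub> = scalar (int (p - 1)) \<oplus>\<^bsub>A\<^esub> scalar \<one>\<^bsub>Zp\<^esub>"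
    by (simp only: s scalar.hom_one A.add.nat_pow_Suc)
  also have "\<dots> = scalar (int (p - 1) \<oplus>\<^bsub>Zp\<^esub> \<one>\<^bsub>Zp\<^esub>)"
    using c by (simp only: scalar.hom_add Zp.one_closed)
  also have "int (p - 1) \<oplus>\<^bsub>Zp\<^esub> \<one>\<^bsub>Zp\<^esub> = \<zero>\<^bsub>Zp\<^esub>"
    using p_gt_1 by (simp add: residue_ring_def of_nat_diff)
  also have "scalar \<zero>\<^bsub>Zp\<^esub> = \<zero>\<^bsub>A\<^esub>"
    by (rule scalar.hom_zero)
  finally show ?thesis using p_gt_1 by simp
qed

sublocale A: prime_char_ring A p
  by unfold_locales (simp_all add: prime char_A)

lemma scalar_central:
  assumes r: "r \<in> carrier Zp" and x: "x \<in> carrier A"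
  shows "scalar r \<otimes>\<^bsub>A\<^esub> x = x \<otimes>\<^bsub>A\<^esub> scalar r"
proof -
  obtain f where f: "f \<in> carrier F" "x = proj f" using proj_surj[OF x] by blast
  have m: "Zp.monomial r [] \<in> carrier F" using r by (intro Zp.monomial_closed) auto
  have "proj (Zp.monomial r [] \<otimes>\<^bsub>F\<^esub> f) = proj (f \<otimes>\<^bsub>F\<^esub> Zp.monomial r [])"
    using Zp.monomial_Nil_central[OF r f(1)] by simp
  then show ?thesis using f m by (simp add: scalar_def)
qed

text \<open>The coefficients are natural multiples of the unit, so no case for scalars or negatives
  has to be proved.\<close>

lemma A_induct [consumes 1, case_names zero one gen add mult]:
  assumes x: "x \<in> carrier A"
    and zero: "P \<zero>\<^bsub>A\<^esub>" and one: "P \<one>\<^bsub>A\<^esub>"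
    and gen: "\<And>a. a \<in> gens n \<Longrightarrow> P (agen a)"
    and add: "\<And>x y. x \<in> carrier A \<Longrightarrow> y \<in> carrier A \<Longrightarrow> P x \<Longrightarrow> P y \<Longrightarrow> P (x \<oplus>\<^bsub>A\<^esub> y)"
    and mult: "\<And>x y. x \<in> carrier A \<Longrightarrow> y \<in> carrier A \<Longrightarrow> P x \<Longrightarrow> P y \<Longrightarrow> P (x \<otimes>\<^bsub>A\<^esub> y)"
  shows "P x"
proof -
  have P_nat: "P (add_pow A k \<one>\<^bsub>A\<^esub>)" for k :: nat
    by (induction k) (simp_all add: zero one add)
  have "P (proj f)" if "f \<in> carrier F" for f
    using that
  proof (induction f rule: Zp.free_algebra_induct)
    case (scalar r)
    then have "r = int (nat r)" "nat r < p" by (auto simp: residue_ring_def)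
    then have "proj (Zp.monomial r []) = add_pow A (nat r) \<one>\<^bsub>A\<^esub>"
      using scalar_eq_add_pow[of "nat r"] by (simp add: scalar_def)
    then show ?case using P_nat by simp
  next
    case (gen a)
    then show ?case using assms(4) by (simp add: agen_def)
  qed (simp_all add: add mult)
  then show ?thesis using proj_surj[OF x] by blast
qed

text \<open>Serves in both directions: for the projection it extracts the commutation rules of the
  algebra from the relations, and for an evaluation map it shows that proposed images satisfy those
  relations.\<close>

lemma hom_commutation_iff:
  assumes h: "ring_hom_ring F S h" and a: "a \<in> gens n" and b: "b \<in> gens n"
  shows "h (fgen p a \<otimes>\<^bsub>F\<^esub> fgen p b \<ominus>\<^bsub>F\<^esub>
      add_pow F ((-1 :: int) ^ (deg p a * deg p b)) (fgen p b \<otimes>\<^bsub>F\<^esub> fgen p a)) = \<zero>\<^bsub>S\<^esub>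
    \<longleftrightarrow> h (fgen p a) \<otimes>\<^bsub>S\<^esub> h (fgen p b) =
      (if even (deg p a * deg p b) then h (fgen p b) \<otimes>\<^bsub>S\<^esub> h (fgen p a)
       else \<ominus>\<^bsub>S\<^esub> (h (fgen p b) \<otimes>\<^bsub>S\<^esub> h (fgen p a)))"
proof -
  interpret h: ring_hom_ring F S h by (rule h)
  note c = fgen_closed[OF a] fgen_closed[OF b]
  let ?e = "(-1 :: int) ^ (deg p a * deg p b)"
  let ?ba = "fgen p b \<otimes>\<^bsub>F\<^esub> fgen p a"
  have "add_pow F ?e ?ba = (if even (deg p a * deg p b) then ?ba else \<ominus>\<^bsub>F\<^esub> ?ba)"
  proof (cases "even (deg p a * deg p b)")
    case True
    then have "?e = 1" by simp
    then show ?thesis using True c F.add.int_pow_1[of ?ba] by simp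
  next
    case False
    then have "?e = - 1" by simp
    then show ?thesis using False c F.add.int_pow_neg[of ?ba 1] by simp
  qed
  moreover have "h (x \<ominus>\<^bsub>F\<^esub> y) = h x \<ominus>\<^bsub>S\<^esub> h y" if "x \<in> carrier F" "y \<in> carrier F" for x y
    using that by (simp add: F.minus_eq h.S.minus_eq)
  ultimately show ?thesis using c by (simp split: if_splits)
qed

lemma agen_swap:
  assumes "a \<in> gens n" "b \<in> gens n"
  shows "agen a \<otimes>\<^bsub>A\<^esub> agen b = (if even (deg p a * deg p b) then agen b \<otimes>\<^bsub>A\<^esub> agen a
    else \<ominus>\<^bsub>A\<^esub> (agen b \<otimes>\<^bsub>A\<^esub> agen a))"
  unfolding agen_def
  by (rule hom_commutation_iff[OF proj.ring_hom_ring_axioms assms, THEN iffD1], rule proj_relation)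
    (use assms in \<open>auto simp: relations_def\<close>)

lemma odd_deg_Tau: "odd (deg p (Tau i))"
  using p_gt_1 by simp

text \<open>The degree of \<open>Xi i\<close> is even, so the sign is positive against every
  generator; the elements commuting with it are closed under sums and products.\<close>

lemma xi_centre: "i \<le> n \<Longrightarrow> \<xi> p n i \<in> A.centre"
proof (cases "i = 0")
  case True
  then show ?thesis by (simp add: \<xi>_def A.one_centre)
next
  case False
  assume "i \<le> n"
  then have X: "Xi i \<in> gens n" using False by (simp add: Xi_gens)
  note c = agen_closed[OF X]
  have "agen (Xi i) \<in> A.centre"
  proof (rule A.centreI)
    fix x assume "x \<in> carrier A"
    then show "agen (Xi i) \<otimes>\<^bsub>A\<^esub> x = x \<otimes>\<^bsub>A\<^esub> agen (Xi i)"
    proof (induction x rule: A_induct)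
      case (gen a)
      then show ?case using agen_swap[OF X gen] by simp
    next
      case (mult x y)
      then show ?case using c by (metis A.m_assoc)
    qed (use c in \<open>simp_all add: A.l_distr A.r_distr\<close>)
  qed (rule c)
  then show ?thesis using False by (simp add: xi_eq_agen)
qed

lemma tau_anticomm:
  "i \<le> n \<Longrightarrow> j \<le> n \<Longrightarrow> \<tau> p n i \<otimes>\<^bsub>A\<^esub> \<tau> p n j = \<ominus>\<^bsub>A\<^esub> (\<tau> p n j \<otimes>\<^bsub>A\<^esub> \<tau> p n i)"
  using agen_swap[of "Tau i" "Tau j"] odd_deg_Tau by (simp add: tau_eq_agen Tau_gens del: deg.simps)

lemma xi_truncated:
  assumes "1 \<le> i" "i \<le> n"
  shows "\<xi> p n i [^]\<^bsub>A\<^esub> (p ^ (n + 1 - i)) = \<zero>\<^bsub>A\<^esub>"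
proof -
  have "fgen p (Xi i) [^]\<^bsub>F\<^esub> (p ^ (n + 1 - i)) \<in> relations p n"
    using assms by (auto simp: relations_def)
  then show ?thesis
    using assms proj_relation by (simp add: xi_eq_agen agen_def fgen_closed Xi_gens flip: proj.hom_nat_pow)
qed

text \<open>The universal property of the presentation. Evaluation at \<open>v\<close> kills the
  relations, hence the ideal they generate, and so factors through the quotient.\<close>

lemma A_lift:
  assumes v: "\<And>a. a \<in> gens n \<Longrightarrow> v a \<in> carrier A"
    and swap: "\<And>a b. a \<in> gens n \<Longrightarrow> b \<in> gens n \<Longrightarrow> v a \<otimes>\<^bsub>A\<^esub> v b =
      (if even (deg p a * deg p b) then v b \<otimes>\<^bsub>A\<^esub> v a else \<ominus>\<^bsub>A\<^esub> (v b \<otimes>\<^bsub>A\<^esub> v a))"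
    and Xi: "\<And>i. 1 \<le> i \<Longrightarrow> i \<le> n \<Longrightarrow> v (Xi i) [^]\<^bsub>A\<^esub> (p ^ (n + 1 - i)) = \<zero>\<^bsub>A\<^esub>"
    and Tau: "\<And>i. i \<le> n \<Longrightarrow> v (Tau i) [^]\<^bsub>A\<^esub> (2::nat) = \<zero>\<^bsub>A\<^esub>"
  shows "\<exists>k \<in> ring_hom A A. \<forall>a \<in> gens n. k (agen a) = v a"
proof -
  interpret E: free_algebra_eval Zp A scalar "gens n" v
    by unfold_locales (auto simp: v scalar_central)
  have hom: "ring_hom_ring F A E.eval_hom"
    by (intro ring_hom_ringI2 F.ring_axioms A.ring_axioms E.eval_hom_ring_hom)
  interpret h: ring_hom_ring F A E.eval_hom by (rule hom)
  have "E.eval_hom r = \<zero>\<^bsub>A\<^esub>" if "r \<in> relations p n" for r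
  proof -
    consider a b where "a \<in> gens n" "b \<in> gens n" "r = fgen p a \<otimes>\<^bsub>F\<^esub> fgen p b \<ominus>\<^bsub>F\<^esub>
        add_pow F ((-1 :: int) ^ (deg p a * deg p b)) (fgen p b \<otimes>\<^bsub>F\<^esub> fgen p a)"
      | i where "1 \<le> i" "i \<le> n" "r = fgen p (Xi i) [^]\<^bsub>F\<^esub> (p ^ (n + 1 - i))"
      | i where "i \<le> n" "r = fgen p (Tau i) [^]\<^bsub>F\<^esub> (2::nat)"
      using \<open>r \<in> relations p n\<close> unfolding relations_def by fastforce
    then show ?thesis
    proof cases
      case 1
      then show ?thesis
        using hom_commutation_iff[OF hom 1(1,2)] swap[OF 1(1,2)] by (simp add: E.eval_hom_gen)
    next
      case 2
      then show ?thesis using Xi by (simp add: h.hom_nat_pow fgen_closed Xi_gens E.eval_hom_gen)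
    next
      case 3
      then show ?thesis using Tau by (simp add: h.hom_nat_pow fgen_closed Tau_gens E.eval_hom_gen)
    qed
  qed
  then have "rel_ideal p n \<subseteq> a_kernel F A E.eval_hom"
    unfolding rel_ideal_def by (intro F.genideal_subset_kernel hom relations_closed)
  from I.quotient_lift[OF hom this] obtain k where
    k: "k \<in> ring_hom A A" "\<forall>f \<in> carrier F. k (proj f) = E.eval_hom f"
    unfolding Adual_def[symmetric] proj_def by blast
  then have "k (agen a) = v a" if "a \<in> gens n" for a
    using fgen_closed[OF that] E.eval_hom_gen[OF that] by (simp add: agen_def)
  then show ?thesis using k(1) by blast
qed

end

section \<open>Signed path sums\<close>

context steenrod_quotient
begin

lemma pverts_cases:
  assumes "v \<in> pverts (K p n)"
  obtains "v = 1" | a where "a \<le> n" "v = 2 * p ^ a"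
  using assms by (auto simp: pverts_K)

lemma pverts_power: "a \<le> n \<Longrightarrow> 2 * p ^ a \<in> pverts (K p n)"
  by (auto simp: pverts_K)

lemma one_pverts: "1 \<in> pverts (K p n)"
  by (simp add: pverts_K)

lemma one_less_vertex: "1 < 2 * p ^ a"
  using p_gt_1 one_le_power[of p a] by linarith

lemma vertex_less_iff: "2 * p ^ a < 2 * p ^ b \<longleftrightarrow> a < b"
  using p_gt_1 by simp

lemma edge_label_closed:
  assumes "e \<in> parcs (K p n)"
  shows "edge_label p n e \<in> carrier A"
proof -
  obtain u v where e: "e = (u, v)" "u \<in> pverts (K p n)" "v \<in> pverts (K p n)" "u < v"
    using assms by (auto simp: parcs_K)
  \<comment> \<open>The target of an arc therefore exceeds 1 and is of the form
    \<open>2 * p ^ b\<close>.\<close>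
  have "1 \<le> u" using e(2) one_less_vertex by (auto elim!: pverts_cases intro: less_imp_le)
  then obtain b where b: "b \<le> n" "v = 2 * p ^ b" using e(3,4) by (auto elim!: pverts_cases)
  show ?thesis
    using e(2)
  proof (cases rule: pverts_cases)
    case 1
    then show ?thesis using b e(1) p_gt_1 by (simp only: edge_label_tau tau_closed)
  next
    case (2 a)
    have "b - a \<le> n" using b by simp
    then show ?thesis
      unfolding e(1) 2 b(2) edge_label_xi[OF p_gt_1] by (intro A.nat_pow_closed xi_closed)
  qed
qed

lemma path_product_closed: "set es \<subseteq> parcs (K p n) \<Longrightarrow> path_product p n es \<in> carrier A"
  by (induction es) (auto simp: path_product_def edge_label_closed)

text \<open>The product is folded from the first edge; associativity gives the form needed for
  splitting off the last one.\<close>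

lemma path_product_snoc:
  assumes "set es \<subseteq> parcs (K p n)" "e \<in> parcs (K p n)"
  shows "path_product p n (es @ [e]) = path_product p n es \<otimes>\<^bsub>A\<^esub> edge_label p n e"
  using assms
proof (induction es)
  case Nil
  then show ?case by (simp add: path_product_def edge_label_closed)
next
  case (Cons e' es)
  have "path_product p n ((e' # es) @ [e]) = edge_label p n e' \<otimes>\<^bsub>A\<^esub> path_product p n (es @ [e])"
    by (simp add: path_product_def)
  also have "\<dots> = edge_label p n e' \<otimes>\<^bsub>A\<^esub> path_product p n es \<otimes>\<^bsub>A\<^esub> edge_label p n e"
    using Cons by (simp add: A.m_assoc edge_label_closed path_product_closed)
  also have "edge_label p n e' \<otimes>\<^bsub>A\<^esub> path_product p n es = path_product p n (e' # es)"
    by (simp add: path_product_def)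
  finally show ?case .
qed

definition signed_product where
  "signed_product es =
    (if even (length es) then path_product p n es else \<ominus>\<^bsub>A\<^esub> path_product p n es)"

lemma signed_path_sum_eq: "signed_path_sum p n u v = (\<Oplus>\<^bsub>A\<^esub>es\<in>paths p n u v. signed_product es)"
  by (simp add: signed_path_sum_def signed_product_def)

lemma signed_product_closed: "es \<in> paths p n u v \<Longrightarrow> signed_product es \<in> carrier A"
  by (auto simp: signed_product_def mem_paths_iff path_product_closed)

lemma signed_path_sum_closed: "signed_path_sum p n u v \<in> carrier A"
  unfolding signed_path_sum_eq by (intro A.finsum_closed) (auto intro: signed_product_closed)

text \<open>One more edge changes the parity of the length, hence the sign.\<close>

lemma signed_product_snoc:
  assumes "es \<in> paths p n u w" "(w, v) \<in> parcs (K p n)"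
  shows "signed_product (es @ [(w, v)]) = \<ominus>\<^bsub>A\<^esub> (signed_product es \<otimes>\<^bsub>A\<^esub> edge_label p n (w, v))"
proof -
  have "set es \<subseteq> parcs (K p n)" using assms(1) by (simp add: mem_paths_iff)
  then show ?thesis using assms(2)
    by (simp add: signed_product_def path_product_snoc path_product_closed edge_label_closed A.l_minus)
qed

lemma signed_path_sum_refl:
  "u \<in> pverts (K p n) \<Longrightarrow> signed_path_sum p n u u = \<one>\<^bsub>A\<^esub>"
  by (simp add: signed_path_sum_eq paths_refl signed_product_def path_product_def)

text \<open>The paths are grouped by their last vertex before \<open>v\<close>. The common sign of
  the additional edge comes out in front.\<close>

lemma signed_path_sum_last_edge:
  assumes u: "u \<in> pverts (K p n)" and v: "v \<in> pverts (K p n)" and uv: "u < v"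
  shows "signed_path_sum p n u v = \<ominus>\<^bsub>A\<^esub> (\<Oplus>\<^bsub>A\<^esub>w\<in>{w \<in> pverts (K p n). u \<le> w \<and> w < v}.
    signed_path_sum p n u w \<otimes>\<^bsub>A\<^esub> edge_label p n (w, v))"
proof -
  let ?W = "{w \<in> pverts (K p n). u \<le> w \<and> w < v}"
  have fin: "finite ?W" using finite_pverts_K[of p n] by simp
  have arc: "(w, v) \<in> parcs (K p n)" if "w \<in> ?W" for w using that v by (simp add: parcs_K)
  have snoc_path: "es @ [(w, v)] \<in> paths p n u v" if "w \<in> ?W" "es \<in> paths p n u w" for w es
    unfolding paths_last_edge[OF assms] using that by blast
  have "signed_path_sum p n u v =
      (\<Oplus>\<^bsub>A\<^esub>w\<in>?W. \<Oplus>\<^bsub>A\<^esub>es\<in>(\<lambda>es. es @ [(w, v)]) ` paths p n u w. signed_product es)"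
    unfolding signed_path_sum_eq[of u v] paths_last_edge[OF assms]
  proof (rule A.add.finprod_UN_disjoint)
    \<comment> \<open>The source of the last edge can be read off the path, so different
      \<open>w\<close> give disjoint sets.\<close>
    show "pairwise (\<lambda>w w'. disjnt ((\<lambda>es. es @ [(w, v)]) ` paths p n u w)
        ((\<lambda>es. es @ [(w', v)]) ` paths p n u w')) ?W"
      by (auto simp: pairwise_def disjnt_def)
  next
    fix w es assume "w \<in> ?W" "es \<in> (\<lambda>es. es @ [(w, v)]) ` paths p n u w"
    then show "signed_product es \<in> carrier A"
      using snoc_path signed_product_closed by blast
  qed (use fin finite_paths in auto)
  also have "\<dots> = (\<Oplus>\<^bsub>A\<^esub>w\<in>?W. \<ominus>\<^bsub>A\<^esub> (signed_path_sum p n u w \<otimes>\<^bsub>A\<^esub> edge_label p n (w, v)))"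
  proof (rule A.add.finprod_cong')
    fix w assume w: "w \<in> ?W"
    have l: "edge_label p n (w, v) \<in> carrier A" using arc[OF w] by (rule edge_label_closed)
    have "(\<Oplus>\<^bsub>A\<^esub>es\<in>(\<lambda>es. es @ [(w, v)]) ` paths p n u w. signed_product es)
        = (\<Oplus>\<^bsub>A\<^esub>es\<in>paths p n u w. signed_product (es @ [(w, v)]))"
      using snoc_path[OF w] by (intro A.add.finprod_reindex) (auto intro: signed_product_closed inj_onI)
    also have "\<dots> = (\<Oplus>\<^bsub>A\<^esub>es\<in>paths p n u w. \<ominus>\<^bsub>A\<^esub> (signed_product es \<otimes>\<^bsub>A\<^esub> edge_label p n (w, v)))"
    proof (rule A.add.finprod_cong')
      fix es assume "es \<in> paths p n u w"
      then show "signed_product (es @ [(w, v)]) = \<ominus>\<^bsub>A\<^esub> (signed_product es \<otimes>\<^bsub>A\<^esub> edge_label p n (w, v))"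
        using arc[OF w] by (rule signed_product_snoc)
    qed (use l in \<open>auto intro: signed_product_closed\<close>)
    also have "\<dots> = \<ominus>\<^bsub>A\<^esub> (\<Oplus>\<^bsub>A\<^esub>es\<in>paths p n u w. signed_product es \<otimes>\<^bsub>A\<^esub> edge_label p n (w, v))"
      using l by (intro A.finsum_minus finite_paths) (auto intro: signed_product_closed)
    also have "(\<Oplus>\<^bsub>A\<^esub>es\<in>paths p n u w. signed_product es \<otimes>\<^bsub>A\<^esub> edge_label p n (w, v))
        = signed_path_sum p n u w \<otimes>\<^bsub>A\<^esub> edge_label p n (w, v)"
      unfolding signed_path_sum_eq using l
      by (intro A.finsum_ldistr[symmetric] finite_paths) (auto intro: signed_product_closed)
    finally show "(\<Oplus>\<^bsub>A\<^esub>es\<in>(\<lambda>es. es @ [(w, v)]) ` paths p n u w. signed_product es)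
        = \<ominus>\<^bsub>A\<^esub> (signed_path_sum p n u w \<otimes>\<^bsub>A\<^esub> edge_label p n (w, v))" .
  qed (auto intro!: A.a_inv_closed A.m_closed signed_path_sum_closed edge_label_closed arc)
  also have "\<dots> = \<ominus>\<^bsub>A\<^esub> (\<Oplus>\<^bsub>A\<^esub>w\<in>?W. signed_path_sum p n u w \<otimes>\<^bsub>A\<^esub> edge_label p n (w, v))"
    using fin arc by (intro A.finsum_minus) (auto intro!: A.m_closed signed_path_sum_closed edge_label_closed)
  finally show ?thesis .
qed

section \<open>The recursions satisfied by the signed path sums\<close>

lemma minus_sum_insert:
  assumes "x \<in> carrier A" "finite T" "i \<notin> T" "\<And>k. k \<in> T \<Longrightarrow> f k \<in> carrier A" "f i = x"
  shows "\<ominus>\<^bsub>A\<^esub> finsum A f (insert i T) = \<ominus>\<^bsub>A\<^esub> x \<ominus>\<^bsub>A\<^esub> finsum A f T"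
proof -
  have "finsum A f (insert i T) = x \<oplus>\<^bsub>A\<^esub> finsum A f T"
    using assms A.finsum_insert[of T i f] by auto
  moreover have "finsum A f T \<in> carrier A"
    using assms by (intro A.finsum_closed) auto
  ultimately show ?thesis using assms by (simp add: A.minus_add A.minus_eq)
qed

text \<open>The candidate for the antipode of \<open>\<xi> p n i\<close> raised to
  \<open>p ^ j\<close>; \<open>j = 0\<close> gives the candidate for the generator itself.\<close>

definition xi_conj where "xi_conj j i = signed_path_sum p n (2 * p ^ j) (2 * p ^ (i + j))"

definition tau_conj where "tau_conj i = signed_path_sum p n 1 (2 * p ^ i)"

lemma xi_conj_closed: "xi_conj j i \<in> carrier A"
  by (simp add: xi_conj_def signed_path_sum_closed)

lemma tau_conj_closed: "tau_conj i \<in> carrier A"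
  by (simp add: tau_conj_def signed_path_sum_closed)

lemma xi_conj_0: "j \<le> n \<Longrightarrow> xi_conj j 0 = \<one>\<^bsub>A\<^esub>"
  by (simp add: xi_conj_def signed_path_sum_refl pverts_power)

lemma xi_pow_centre: "i \<le> n \<Longrightarrow> \<xi> p n i [^]\<^bsub>A\<^esub> (k::nat) \<in> A.centre"
  by (simp add: A.pow_centre xi_centre)

lemma xi_pow_closed: "i \<le> n \<Longrightarrow> \<xi> p n i [^]\<^bsub>A\<^esub> (k::nat) \<in> carrier A"
  by (simp add: xi_closed)

text \<open>The possible sources of the last edge are the vertices \<open>2 * p ^ (k + j)\<close>
  with \<open>k < i\<close>. The edge labels are central and may be moved to the left, where the
  recursion of the antipode has them.\<close>

lemma xi_conj_rec:
  assumes i: "1 \<le> i" "i + j \<le> n"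
  shows "xi_conj j i = \<ominus>\<^bsub>A\<^esub> (\<xi> p n i [^]\<^bsub>A\<^esub> (p ^ j)) \<ominus>\<^bsub>A\<^esub>
    (\<Oplus>\<^bsub>A\<^esub>k\<in>{1..<i}. \<xi> p n (i - k) [^]\<^bsub>A\<^esub> (p ^ (k + j)) \<otimes>\<^bsub>A\<^esub> xi_conj j k)"
proof -
  let ?u = "2 * p ^ j" and ?v = "2 * p ^ (i + j)"
  let ?f = "\<lambda>k. \<xi> p n (i - k) [^]\<^bsub>A\<^esub> (p ^ (k + j)) \<otimes>\<^bsub>A\<^esub> xi_conj j k"
  have W: "{w \<in> pverts (K p n). ?u \<le> w \<and> w < ?v} = (\<lambda>k. 2 * p ^ (k + j)) ` {0..<i}"
  proof (intro subset_antisym subsetI)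
    fix w assume w: "w \<in> {w \<in> pverts (K p n). ?u \<le> w \<and> w < ?v}"
    then have "w \<in> pverts (K p n)" by simp
    then show "w \<in> (\<lambda>k. 2 * p ^ (k + j)) ` {0..<i}"
    proof (cases rule: pverts_cases)
      case 1
      then show ?thesis using w one_less_vertex[of j] by simp
    next
      case (2 a)
      then have "j \<le> a" "a < i + j"
        using w vertex_less_iff[of a j] vertex_less_iff[of a "i + j"] by auto
      then have "a = (a - j) + j" "a - j \<in> {0..<i}" by auto
      then show ?thesis unfolding 2 by (metis image_eqI)
    qed
  next
    fix w assume "w \<in> (\<lambda>k. 2 * p ^ (k + j)) ` {0..<i}"
    then obtain k where k: "k < i" "w = 2 * p ^ (k + j)" by auto
    then show "w \<in> {w \<in> pverts (K p n). ?u \<le> w \<and> w < ?v}"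
      using i pverts_power[of "k + j"] vertex_less_iff[of "k + j" "i + j"] vertex_less_iff[of "k + j" j]
      by (auto simp: not_less)
  qed
  have inj: "inj_on (\<lambda>k. 2 * p ^ (k + j)) {0..<i}"
    using p_gt_1 by (auto simp: inj_on_def)
  have f: "?f k \<in> carrier A" for k
    using i xi_pow_closed[of "i - k"] xi_conj_closed by simp
  have lab: "signed_path_sum p n ?u (2 * p ^ (k + j)) \<otimes>\<^bsub>A\<^esub> edge_label p n (2 * p ^ (k + j), ?v) = ?f k"
    for k
  proof -
    have "\<xi> p n (i - k) [^]\<^bsub>A\<^esub> (p ^ (k + j)) \<in> A.centre" using i by (intro xi_pow_centre) simp
    then show ?thesis
      by (simp add: edge_label_xi[OF p_gt_1] xi_conj_closed A.centre_comm flip: xi_conj_def)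
  qed
  have "xi_conj j i = \<ominus>\<^bsub>A\<^esub> (\<Oplus>\<^bsub>A\<^esub>w\<in>(\<lambda>k. 2 * p ^ (k + j)) ` {0..<i}.
      signed_path_sum p n ?u w \<otimes>\<^bsub>A\<^esub> edge_label p n (w, ?v))"
    unfolding xi_conj_def W[symmetric]
    using i by (intro signed_path_sum_last_edge pverts_power) (auto simp: vertex_less_iff simp del: mult_less_cancel1)
  also have "\<dots> = \<ominus>\<^bsub>A\<^esub> (\<Oplus>\<^bsub>A\<^esub>k\<in>{0..<i}. signed_path_sum p n ?u (2 * p ^ (k + j)) \<otimes>\<^bsub>A\<^esub>
      edge_label p n (2 * p ^ (k + j), ?v))"
    using inj f by (subst A.add.finprod_reindex) (auto simp: lab simp del: A.m_closed)
  \<comment> \<open>The index 0 belongs to the direct edge, preceded by the empty path. It becomes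
    the separate leading term.\<close>
  also have "\<dots> = \<ominus>\<^bsub>A\<^esub> (\<Oplus>\<^bsub>A\<^esub>k\<in>insert 0 {1..<i}. ?f k)"
  proof -
    have "{0..<i} = insert 0 {1..<i}" using i by auto
    then show ?thesis by (simp only: lab)
  qed
  also have "\<dots> = \<ominus>\<^bsub>A\<^esub> (\<xi> p n i [^]\<^bsub>A\<^esub> (p ^ j)) \<ominus>\<^bsub>A\<^esub> (\<Oplus>\<^bsub>A\<^esub>k\<in>{1..<i}. ?f k)"
    using i by (intro minus_sum_insert f) (auto simp: xi_conj_0 xi_closed)
  finally show ?thesis .
qed

text \<open>The direct edge now starts at the vertex 1 and carries \<open>\<tau> p n i\<close>. The
  index \<open>k = 0\<close> stays in the sum, since \<open>2 * p ^ 0\<close> is an intermediate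
  vertex.\<close>

lemma tau_conj_rec:
  assumes i: "i \<le> n"
  shows "tau_conj i = \<ominus>\<^bsub>A\<^esub> \<tau> p n i \<ominus>\<^bsub>A\<^esub>
    (\<Oplus>\<^bsub>A\<^esub>k\<in>{0..<i}. \<xi> p n (i - k) [^]\<^bsub>A\<^esub> (p ^ k) \<otimes>\<^bsub>A\<^esub> tau_conj k)"
proof -
  let ?v = "2 * p ^ i"
  let ?f = "\<lambda>k. \<xi> p n (i - k) [^]\<^bsub>A\<^esub> (p ^ k) \<otimes>\<^bsub>A\<^esub> tau_conj k"
  let ?g = "\<lambda>w. signed_path_sum p n 1 w \<otimes>\<^bsub>A\<^esub> edge_label p n (w, ?v)"
  let ?P = "(\<lambda>k. 2 * p ^ k) ` {0..<i}"
  have W: "{w \<in> pverts (K p n). 1 \<le> w \<and> w < ?v} = insert 1 ?P"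
  proof (intro subset_antisym subsetI)
    fix w assume w: "w \<in> {w \<in> pverts (K p n). 1 \<le> w \<and> w < ?v}"
    then have "w \<in> pverts (K p n)" by simp
    then show "w \<in> insert 1 ?P"
    proof (cases rule: pverts_cases)
      case (2 a)
      then show ?thesis using w vertex_less_iff[of a i] by auto
    qed simp
  next
    fix w assume "w \<in> insert 1 ?P"
    then consider "w = 1" | k where "k < i" "w = 2 * p ^ k" by auto
    then show "w \<in> {w \<in> pverts (K p n). 1 \<le> w \<and> w < ?v}"
    proof cases
      case 1
      then show ?thesis using one_pverts one_less_vertex[of i] by simp
    next
      case (2 k)
      then show ?thesis
        using i pverts_power[of k] one_less_vertex[of k] vertex_less_iff[of k i] by auto
    qed
  qed
  have inj: "inj_on (\<lambda>k. 2 * p ^ k) {0..<i}"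
    using p_gt_1 by (auto simp: inj_on_def)
  have f: "?f k \<in> carrier A" for k
    using i xi_pow_closed[of "i - k"] tau_conj_closed by simp
  have lab: "?g (2 * p ^ k) = ?f k" for k
  proof -
    have "\<xi> p n (i - k) [^]\<^bsub>A\<^esub> (p ^ k) \<in> A.centre" using i by (intro xi_pow_centre) simp
    then show ?thesis
      by (simp only: edge_label_xi[OF p_gt_1] tau_conj_closed A.centre_comm flip: tau_conj_def)
  qed
  have g1: "?g 1 = \<tau> p n i"
    using i by (simp only: signed_path_sum_refl[OF one_pverts] edge_label_tau[OF p_gt_1] A.l_one tau_closed)
  \<comment> \<open>All powers give vertices larger than 1, so the direct edge is not counted
    twice.\<close>
  have "1 \<notin> ?P" using one_less_vertex by (metis imageE less_irrefl)
  then have "\<ominus>\<^bsub>A\<^esub> finsum A ?g (insert 1 ?P) = \<ominus>\<^bsub>A\<^esub> \<tau> p n i \<ominus>\<^bsub>A\<^esub> finsum A ?g ?P"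
    using i f g1 by (intro minus_sum_insert) (auto simp: lab tau_closed simp del: A.m_closed One_nat_def)
  moreover have "finsum A ?g ?P = finsum A ?f {0..<i}"
    using inj f by (subst A.add.finprod_reindex) (auto simp: lab simp del: A.m_closed One_nat_def)
  moreover have "tau_conj i = \<ominus>\<^bsub>A\<^esub> finsum A ?g (insert 1 ?P)"
    unfolding tau_conj_def W[symmetric]
    using i by (intro signed_path_sum_last_edge pverts_power one_pverts one_less_vertex)
  ultimately show ?thesis by simp
qed

end

section \<open>The antipode\<close>

lemma (in prime_char_ring) frobenius_minus_sum:
  assumes x: "x \<in> centre" and T: "finite T" "\<And>i. i \<in> T \<Longrightarrow> f i \<in> centre"
  shows "(\<ominus> x \<ominus> (\<Oplus>i\<in>T. f i)) [^] (p ^ j) = \<ominus> (x [^] (p ^ j)) \<ominus> (\<Oplus>i\<in>T. f i [^] (p ^ j))"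
proof -
  have s: "(\<Oplus>i\<in>T. f i) \<in> centre" using T by (rule finsum_centre)
  have "(\<ominus> x \<oplus> \<ominus> (\<Oplus>i\<in>T. f i)) [^] (p ^ j) = (\<ominus> x) [^] (p ^ j) \<oplus> (\<ominus> (\<Oplus>i\<in>T. f i)) [^] (p ^ j)"
    using x s by (intro frobenius_add minus_centre)
  then show ?thesis
    unfolding minus_eq by (simp only: frobenius_minus[OF x] frobenius_minus[OF s] frobenius_finsum[OF T])
qed

text \<open>The hypothesis gives \<open>2 y = 0\<close>. With \<open>p = 2 q + 1\<close> the
  multiple \<open>p y\<close> equals \<open>y\<close>, but it also vanishes by the
  characteristic.\<close>

lemma (in prime_char_ring) eq_minus_imp_zero:
  assumes "odd p" and y: "y \<in> carrier R" and eq: "y = \<ominus> y"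
  shows "y = \<zero>"
proof -
  obtain q where q: "p = 2 * q + 1" using \<open>odd p\<close> by (rule oddE)
  have "y \<oplus> y = \<zero>" using y eq by (metis r_neg)
  then have "add_pow R (2::nat) y = \<zero>" using y by (simp add: numeral_2_eq_2)
  then have "add_pow R (2 * q) y = \<zero>"
    using y by (simp flip: add.nat_pow_pow)
  then have "add_pow R p y = y" using y by (simp add: q)
  moreover have "add_pow R p y = \<zero>" using y by (intro add_pow_eq_zero[OF char_p]) auto
  ultimately show ?thesis by simp
qed

section \<open>The path sums satisfy the defining relations\<close>

context steenrod_quotient
begin

text \<open>Induction along the recursion, all of whose ingredients are central.\<close>

lemma xi_conj_centre: "i + j \<le> n \<Longrightarrow> xi_conj j i \<in> A.centre"
proof (induction i rule: less_induct)
  case (less i)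
  show ?case
  proof (cases "i = 0")
    case True
    then show ?thesis using less.prems by (simp add: xi_conj_0 A.one_centre)
  next
    case False
    have "(\<Oplus>\<^bsub>A\<^esub>k\<in>{1..<i}. \<xi> p n (i - k) [^]\<^bsub>A\<^esub> (p ^ (k + j)) \<otimes>\<^bsub>A\<^esub> xi_conj j k) \<in> A.centre"
      using less by (intro A.finsum_centre A.mult_centre xi_pow_centre less.IH) auto
    then show ?thesis
      using False less.prems
      by (simp add: xi_conj_rec A.minus_eq A.add_centre A.minus_centre xi_pow_centre)
  qed
qed

text \<open>Raising to \<open>p ^ j\<close> turns the exponent \<open>p ^ k\<close> into
  \<open>p ^ (k + j)\<close>. The exponent \<open>j\<close> is not bounded by \<open>n - i\<close>,
  because truncation needs the case \<open>j = n + 1 - i\<close>.\<close>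

lemma xi_conj_0_frobenius:
  assumes "1 \<le> i" "i \<le> n"
  shows "xi_conj 0 i [^]\<^bsub>A\<^esub> (p ^ j) = \<ominus>\<^bsub>A\<^esub> (\<xi> p n i [^]\<^bsub>A\<^esub> (p ^ j)) \<ominus>\<^bsub>A\<^esub>
    (\<Oplus>\<^bsub>A\<^esub>k\<in>{1..<i}. \<xi> p n (i - k) [^]\<^bsub>A\<^esub> (p ^ (k + j)) \<otimes>\<^bsub>A\<^esub> (xi_conj 0 k [^]\<^bsub>A\<^esub> (p ^ j)))"
proof -
  let ?f = "\<lambda>k. \<xi> p n (i - k) [^]\<^bsub>A\<^esub> (p ^ (k + 0)) \<otimes>\<^bsub>A\<^esub> xi_conj 0 k"
  have "xi_conj 0 i = \<ominus>\<^bsub>A\<^esub> \<xi> p n i \<ominus>\<^bsub>A\<^esub> (\<Oplus>\<^bsub>A\<^esub>k\<in>{1..<i}. ?f k)"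
    using assms xi_conj_rec[of i 0] by (simp add: xi_closed)
  moreover have "?f k \<in> A.centre" if "k \<in> {1..<i}" for k
    using that assms by (intro A.mult_centre xi_pow_centre xi_conj_centre) auto
  ultimately have "xi_conj 0 i [^]\<^bsub>A\<^esub> (p ^ j) =
      \<ominus>\<^bsub>A\<^esub> (\<xi> p n i [^]\<^bsub>A\<^esub> (p ^ j)) \<ominus>\<^bsub>A\<^esub> (\<Oplus>\<^bsub>A\<^esub>k\<in>{1..<i}. ?f k [^]\<^bsub>A\<^esub> (p ^ j))"
    using assms by (simp only: A.frobenius_minus_sum xi_centre finite_atLeastLessThan)
  also have "(\<Oplus>\<^bsub>A\<^esub>k\<in>{1..<i}. ?f k [^]\<^bsub>A\<^esub> (p ^ j)) =
    (\<Oplus>\<^bsub>A\<^esub>k\<in>{1..<i}. \<xi> p n (i - k) [^]\<^bsub>A\<^esub> (p ^ (k + j)) \<otimes>\<^bsub>A\<^esub> (xi_conj 0 k [^]\<^bsub>A\<^esub> (p ^ j)))"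
  proof (rule A.add.finprod_cong')
    fix k assume "k \<in> {1..<i}"
    then have "i - k \<le> n" using assms by auto
    then show "?f k [^]\<^bsub>A\<^esub> (p ^ j) =
        \<xi> p n (i - k) [^]\<^bsub>A\<^esub> (p ^ (k + j)) \<otimes>\<^bsub>A\<^esub> (xi_conj 0 k [^]\<^bsub>A\<^esub> (p ^ j))"
      by (simp add: A.frobenius_mult xi_pow_centre xi_conj_closed A.nat_pow_pow xi_closed power_add)
  qed (use assms in \<open>auto simp: xi_pow_closed xi_conj_closed\<close>)
  finally show ?thesis .
qed

text \<open>Both sides obey the same recursion in \<open>i\<close>, by
  \<open>xi_conj_0_frobenius\<close> and \<open>xi_conj_rec\<close>.\<close>

lemma xi_conj_0_pow: "i + j \<le> n \<Longrightarrow> xi_conj 0 i [^]\<^bsub>A\<^esub> (p ^ j) = xi_conj j i"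
proof (induction i rule: less_induct)
  case (less i)
  show ?case
  proof (cases "i = 0")
    case True
    then show ?thesis using less.prems by (simp add: xi_conj_0)
  next
    case False
    have "(\<Oplus>\<^bsub>A\<^esub>k\<in>{1..<i}. \<xi> p n (i - k) [^]\<^bsub>A\<^esub> (p ^ (k + j)) \<otimes>\<^bsub>A\<^esub> (xi_conj 0 k [^]\<^bsub>A\<^esub> (p ^ j))) =
        (\<Oplus>\<^bsub>A\<^esub>k\<in>{1..<i}. \<xi> p n (i - k) [^]\<^bsub>A\<^esub> (p ^ (k + j)) \<otimes>\<^bsub>A\<^esub> xi_conj j k)"
      using less by (intro A.add.finprod_cong') (auto simp: xi_pow_closed xi_conj_closed)
    then show ?thesis
      using False less.prems xi_conj_0_frobenius[of i j] xi_conj_rec[of i j] by simp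
  qed
qed

lemma xi_conj_truncated:
  assumes "1 \<le> i" "i \<le> n"
  shows "xi_conj 0 i [^]\<^bsub>A\<^esub> (p ^ (n + 1 - i)) = \<zero>\<^bsub>A\<^esub>"
proof -
  let ?j = "n + 1 - i"
  have "\<xi> p n (i - k) [^]\<^bsub>A\<^esub> (p ^ (k + ?j)) = \<zero>\<^bsub>A\<^esub>" if "k < i" for k
  proof -
    \<comment> \<open>This is exactly the exponent at which \<open>\<xi> p n (i - k)\<close> is
      truncated, so every term of the recursion vanishes.\<close>
    have "k + ?j = n + 1 - (i - k)" using that assms by auto
    then show ?thesis using that assms by (simp only:) (rule xi_truncated, auto)
  qed
  moreover from this[of 0] have "\<xi> p n i [^]\<^bsub>A\<^esub> (p ^ ?j) = \<zero>\<^bsub>A\<^esub>" using assms by simp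
  ultimately have "xi_conj 0 i [^]\<^bsub>A\<^esub> (p ^ ?j) = \<ominus>\<^bsub>A\<^esub> \<zero>\<^bsub>A\<^esub> \<ominus>\<^bsub>A\<^esub> (\<Oplus>\<^bsub>A\<^esub>k\<in>{1..<i}. \<zero>\<^bsub>A\<^esub>)"
    unfolding xi_conj_0_frobenius[OF assms]
    by (intro arg_cong2[where f = "a_minus A"] A.add.finprod_cong') (auto simp: xi_conj_closed)
  then show ?thesis by simp
qed

text \<open>The set \<open>S\<close> is left arbitrary because the lemma is used twice, for the
  \<open>\<tau>\<close> themselves and for their anticommutant.\<close>

lemma tau_conj_anticommutant:
  assumes S: "S \<subseteq> carrier A" and tau: "\<And>i. i \<le> n \<Longrightarrow> \<tau> p n i \<in> A.anticommutant S"
  shows "i \<le> n \<Longrightarrow> tau_conj i \<in> A.anticommutant S"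
proof (induction i rule: less_induct)
  case (less i)
  have "(\<Oplus>\<^bsub>A\<^esub>k\<in>{0..<i}. \<xi> p n (i - k) [^]\<^bsub>A\<^esub> (p ^ k) \<otimes>\<^bsub>A\<^esub> tau_conj k) \<in> A.anticommutant S"
    using less S by (intro A.anticommutant_finsum A.anticommutant_centre_mult xi_pow_centre less.IH) auto
  then show ?case
    unfolding tau_conj_rec[OF less.prems] A.minus_eq
    using S tau[OF less.prems] by (intro A.anticommutant_add A.anticommutant_minus)
qed

text \<open>The \<open>\<tau>\<^sub>i\<close>, hence also their conjugates, lie both in the anticommutant \<open>S\<close> of all \<open>\<tau>\<^sub>k\<close> and in
  the anticommutant of \<open>S\<close>. This avoids expanding products of sums.\<close>

lemma tau_conj_anticomm:
  assumes i: "i \<le> n" and j: "j \<le> n"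
  shows "tau_conj i \<otimes>\<^bsub>A\<^esub> tau_conj j = \<ominus>\<^bsub>A\<^esub> (tau_conj j \<otimes>\<^bsub>A\<^esub> tau_conj i)"
proof -
  define S where "S = A.anticommutant (\<tau> p n ` {..n})"
  have S: "S \<subseteq> carrier A" by (auto simp: S_def A.anticommutant_def)
  have "\<tau> p n k \<in> A.anticommutant S" if "k \<le> n" for k
  proof -
    have "\<tau> p n k \<otimes>\<^bsub>A\<^esub> y = \<ominus>\<^bsub>A\<^esub> (y \<otimes>\<^bsub>A\<^esub> \<tau> p n k)" if "y \<in> S" for y
    proof -
      have "y \<otimes>\<^bsub>A\<^esub> \<tau> p n k = \<ominus>\<^bsub>A\<^esub> (\<tau> p n k \<otimes>\<^bsub>A\<^esub> y)"
        using \<open>y \<in> S\<close> \<open>k \<le> n\<close> unfolding S_def by (intro A.anticommutantD) auto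
      then show ?thesis using \<open>y \<in> S\<close> \<open>k \<le> n\<close> S tau_closed by auto
    qed
    then show ?thesis using \<open>k \<le> n\<close> by (simp add: A.anticommutant_def tau_closed)
  qed
  then have "tau_conj i \<in> A.anticommutant S"
    using S i by (intro tau_conj_anticommutant)
  moreover have "\<tau> p n k \<in> S" if "k \<le> n" for k
    unfolding S_def A.anticommutant_def
  proof (intro CollectI conjI ballI)
    fix y assume "y \<in> \<tau> p n ` {..n}"
    then obtain l where l: "l \<le> n" "y = \<tau> p n l" by auto
    show "\<tau> p n k \<otimes>\<^bsub>A\<^esub> y = \<ominus>\<^bsub>A\<^esub> (y \<otimes>\<^bsub>A\<^esub> \<tau> p n k)"
      unfolding l(2) using that l(1) by (rule tau_anticomm)
  qed (rule tau_closed[OF that])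
  then have "tau_conj j \<in> S"
    unfolding S_def using j by (intro tau_conj_anticommutant) (auto intro: tau_closed)
  ultimately show ?thesis by (rule A.anticommutantD)
qed

text \<open>Anticommutation of the element with itself makes its square equal to its own negative,
  which forces zero for odd \<open>p\<close>.\<close>

lemma tau_conj_square: "i \<le> n \<Longrightarrow> tau_conj i [^]\<^bsub>A\<^esub> (2::nat) = \<zero>\<^bsub>A\<^esub>"
proof -
  assume i: "i \<le> n"
  have "tau_conj i \<otimes>\<^bsub>A\<^esub> tau_conj i = \<zero>\<^bsub>A\<^esub>"
    by (rule A.eq_minus_imp_zero[OF odd _ tau_conj_anticomm[OF i i]]) (simp add: tau_conj_closed)
  then show ?thesis by (simp add: numeral_2_eq_2 tau_conj_closed)
qed

section \<open>Existence and uniqueness of the antipode and its values\<close>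

fun gen_conj where
  "gen_conj (Xi i) = xi_conj 0 i"
| "gen_conj (Tau i) = tau_conj i"

lemma gens_cases:
  assumes "a \<in> gens n"
  obtains i where "1 \<le> i" "i \<le> n" "a = Xi i" | i where "i \<le> n" "a = Tau i"
  using assms by (auto simp: gens_def)

lemma gen_conj_closed: "gen_conj a \<in> carrier A"
  by (cases a) (simp_all add: xi_conj_closed tau_conj_closed)

text \<open>If one generator is some \<open>Xi\<close>, the product of degrees is even and its image
  is central. Two \<open>Tau\<close> have odd degrees and anticommuting images.\<close>

lemma gen_conj_swap:
  assumes a: "a \<in> gens n" and b: "b \<in> gens n"
  shows "gen_conj a \<otimes>\<^bsub>A\<^esub> gen_conj b = (if even (deg p a * deg p b) then gen_conj b \<otimes>\<^bsub>A\<^esub> gen_conj a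
    else \<ominus>\<^bsub>A\<^esub> (gen_conj b \<otimes>\<^bsub>A\<^esub> gen_conj a))"
  using a
proof (cases rule: gens_cases)
  case (1 i)
  then show ?thesis
    using A.centre_comm[OF xi_conj_centre[of i 0] gen_conj_closed[of b]] by simp
next
  case a: (2 i)
  show ?thesis
    using b
  proof (cases rule: gens_cases)
    case (1 j)
    then show ?thesis
      using A.centre_comm[OF xi_conj_centre[of j 0] gen_conj_closed[of a]] by simp
  next
    case (2 j)
    then show ?thesis
      using a tau_conj_anticomm[of i j] odd_deg_Tau[of i] odd_deg_Tau[of j]
      by (simp del: deg.simps)
  qed
qed

text \<open>Replaces the recursive characterisation by explicit values on generators. In one
  direction the recursions force these values by strong induction; in the other the path sums
  satisfy the recursions.\<close>

lemma is_antipode_iff: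
  "is_antipode p n c \<longleftrightarrow> c \<in> ring_hom A A \<and> (\<forall>a \<in> gens n. c (agen a) = gen_conj a)"
proof
  assume c: "is_antipode p n c"
  then have hom: "c \<in> ring_hom A A" by (simp add: is_antipode_def)
  have xi: "c (\<xi> p n i) = xi_conj 0 i" if "1 \<le> i" "i \<le> n" for i
    using that
  proof (induction i rule: less_induct)
    case (less i)
    have "(\<Oplus>\<^bsub>A\<^esub>k\<in>{1..<i}. \<xi> p n (i - k) [^]\<^bsub>A\<^esub> (p ^ k) \<otimes>\<^bsub>A\<^esub> c (\<xi> p n k)) =
        (\<Oplus>\<^bsub>A\<^esub>k\<in>{1..<i}. \<xi> p n (i - k) [^]\<^bsub>A\<^esub> (p ^ (k + 0)) \<otimes>\<^bsub>A\<^esub> xi_conj 0 k)"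
      using less by (intro A.add.finprod_cong') (auto simp: xi_pow_closed xi_conj_closed)
    moreover have "c (\<xi> p n i) = \<ominus>\<^bsub>A\<^esub> \<xi> p n i \<ominus>\<^bsub>A\<^esub>
        (\<Oplus>\<^bsub>A\<^esub>k\<in>{1..<i}. \<xi> p n (i - k) [^]\<^bsub>A\<^esub> (p ^ k) \<otimes>\<^bsub>A\<^esub> c (\<xi> p n k))"
      using c less.prems unfolding is_antipode_def by simp
    ultimately show ?case
      using less.prems xi_conj_rec[of i 0] by (simp add: xi_closed)
  qed
  have tau: "c (\<tau> p n i) = tau_conj i" if "i \<le> n" for i
    using that
  proof (induction i rule: less_induct)
    case (less i)
    have "(\<Oplus>\<^bsub>A\<^esub>k\<in>{0..<i}. \<xi> p n (i - k) [^]\<^bsub>A\<^esub> (p ^ k) \<otimes>\<^bsub>A\<^esub> c (\<tau> p n k)) =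
        (\<Oplus>\<^bsub>A\<^esub>k\<in>{0..<i}. \<xi> p n (i - k) [^]\<^bsub>A\<^esub> (p ^ k) \<otimes>\<^bsub>A\<^esub> tau_conj k)"
      using less by (intro A.add.finprod_cong') (auto simp: xi_pow_closed tau_conj_closed)
    moreover have "c (\<tau> p n i) = \<ominus>\<^bsub>A\<^esub> \<tau> p n i \<ominus>\<^bsub>A\<^esub>
        (\<Oplus>\<^bsub>A\<^esub>k\<in>{0..<i}. \<xi> p n (i - k) [^]\<^bsub>A\<^esub> (p ^ k) \<otimes>\<^bsub>A\<^esub> c (\<tau> p n k))"
      using c less.prems unfolding is_antipode_def by simp
    ultimately show ?case
      using tau_conj_rec[OF less.prems] by simp
  qed
  have "c (agen a) = gen_conj a" if "a \<in> gens n" for a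
    using that
  proof (cases rule: gens_cases)
    case (1 i)
    then show ?thesis using xi[of i] by (simp add: xi_eq_agen)
  next
    case (2 i)
    then show ?thesis using tau[of i] by (simp add: tau_eq_agen)
  qed
  then show "c \<in> ring_hom A A \<and> (\<forall>a \<in> gens n. c (agen a) = gen_conj a)"
    using hom by blast
next
  assume "c \<in> ring_hom A A \<and> (\<forall>a \<in> gens n. c (agen a) = gen_conj a)"
  then have hom: "c \<in> ring_hom A A" and gen: "\<And>a. a \<in> gens n \<Longrightarrow> c (agen a) = gen_conj a"
    by auto
  have xi: "c (\<xi> p n i) = xi_conj 0 i" if "1 \<le> i" "i \<le> n" for i
    using that gen[of "Xi i"] by (simp add: xi_eq_agen Xi_gens)
  have tau: "c (\<tau> p n i) = tau_conj i" if "i \<le> n" for i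
    using that gen[of "Tau i"] by (simp add: tau_eq_agen Tau_gens)
  have "c (\<xi> p n m) = \<ominus>\<^bsub>A\<^esub> \<xi> p n m \<ominus>\<^bsub>A\<^esub>
      (\<Oplus>\<^bsub>A\<^esub>k\<in>{1..<m}. \<xi> p n (m - k) [^]\<^bsub>A\<^esub> (p ^ k) \<otimes>\<^bsub>A\<^esub> c (\<xi> p n k))" if m: "m \<in> {1..n}" for m
  proof -
    have "(\<Oplus>\<^bsub>A\<^esub>k\<in>{1..<m}. \<xi> p n (m - k) [^]\<^bsub>A\<^esub> (p ^ k) \<otimes>\<^bsub>A\<^esub> c (\<xi> p n k)) =
        (\<Oplus>\<^bsub>A\<^esub>k\<in>{1..<m}. \<xi> p n (m - k) [^]\<^bsub>A\<^esub> (p ^ (k + 0)) \<otimes>\<^bsub>A\<^esub> xi_conj 0 k)"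
      using m xi by (intro A.add.finprod_cong') (auto simp: xi_pow_closed xi_conj_closed)
    then show ?thesis using m xi[of m] xi_conj_rec[of m 0] by (simp add: xi_closed)
  qed
  moreover have "c (\<tau> p n m) = \<ominus>\<^bsub>A\<^esub> \<tau> p n m \<ominus>\<^bsub>A\<^esub>
      (\<Oplus>\<^bsub>A\<^esub>k\<in>{0..<m}. \<xi> p n (m - k) [^]\<^bsub>A\<^esub> (p ^ k) \<otimes>\<^bsub>A\<^esub> c (\<tau> p n k))" if m: "m \<in> {0..n}" for m
  proof -
    have "(\<Oplus>\<^bsub>A\<^esub>k\<in>{0..<m}. \<xi> p n (m - k) [^]\<^bsub>A\<^esub> (p ^ k) \<otimes>\<^bsub>A\<^esub> c (\<tau> p n k)) =
        (\<Oplus>\<^bsub>A\<^esub>k\<in>{0..<m}. \<xi> p n (m - k) [^]\<^bsub>A\<^esub> (p ^ k) \<otimes>\<^bsub>A\<^esub> tau_conj k)"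
      using m tau by (intro A.add.finprod_cong') (auto simp: xi_pow_closed tau_conj_closed)
    then show ?thesis using m tau[of m] tau_conj_rec[of m] by simp
  qed
  \<comment> \<open>\<open>\<xi> p n 0\<close> is the unit by definition, so any unital map fixes
    it.\<close>
  moreover have "c (\<xi> p n 0) = \<one>\<^bsub>A\<^esub>"
    using hom by (simp add: \<xi>_def ring_hom_one)
  ultimately show "is_antipode p n c"
    using hom unfolding is_antipode_def by blast
qed

text \<open>Existence comes from the universal property \<open>A_lift\<close>; uniqueness holds
  because two homomorphisms agreeing on the generators agree on the carrier.\<close>

lemma ex1_antipode: "\<exists>!c. c \<in> extensional (carrier A) \<and> is_antipode p n c"
proof (rule ex_ex1I)
  obtain k where k: "k \<in> ring_hom A A" "\<forall>a \<in> gens n. k (agen a) = gen_conj a"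
    using A_lift[of gen_conj] gen_conj_closed gen_conj_swap xi_conj_truncated tau_conj_square
    by auto
  \<comment> \<open>Restriction makes the map \<open>extensional\<close> without changing it on the
    carrier.\<close>
  have "restrict k (carrier A) \<in> ring_hom A A"
    using A.ring_hom_restrict[OF k(1)] by simp
  then have "is_antipode p n (restrict k (carrier A))"
    using k(2) by (simp add: is_antipode_iff agen_closed)
  then show "\<exists>c. c \<in> extensional (carrier A) \<and> is_antipode p n c"
    by (intro exI[of _ "restrict k (carrier A)"]) simp
next
  fix c d
  assume c: "c \<in> extensional (carrier A) \<and> is_antipode p n c"
    and d: "d \<in> extensional (carrier A) \<and> is_antipode p n d"
  interpret c: ring_hom_ring A A c
    using c by (intro ring_hom_ringI2 A.ring_axioms) (simp add: is_antipode_iff)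
  interpret d: ring_hom_ring A A d
    using d by (intro ring_hom_ringI2 A.ring_axioms) (simp add: is_antipode_iff)
  have "c x = d x" if "x \<in> carrier A" for x
    using that
  proof (induction x rule: A_induct)
    case (gen a)
    then show ?case using c d by (simp add: is_antipode_iff)
  qed simp_all
  then show "c = d" using c d by (intro extensionalityI[of c "carrier A" d]) auto
qed

lemma is_antipode_antipode: "is_antipode p n (antipode p n)"
  unfolding antipode_def using theI'[OF ex1_antipode] by blast

text \<open>The antipode preserves powers, and \<open>xi_conj_0_pow\<close> identifies the power of
  the path sum from \<open>2 * p ^ 0\<close> with the path sum from
  \<open>2 * p ^ j\<close>.\<close>

lemma antipode_xi_pow:
  assumes "1 \<le> i" "i + j \<le> n"
  shows "antipode p n (\<xi> p n i [^]\<^bsub>A\<^esub> (p ^ j)) = xi_conj j i"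
proof -
  interpret c: ring_hom_ring A A "antipode p n"
    using is_antipode_antipode by (intro ring_hom_ringI2 A.ring_axioms) (simp add: is_antipode_iff)
  have "antipode p n (\<xi> p n i) = xi_conj 0 i"
    using is_antipode_antipode assms by (simp add: is_antipode_iff xi_eq_agen Xi_gens)
  then show ?thesis using assms by (simp add: c.hom_nat_pow xi_closed xi_conj_0_pow)
qed

lemma antipode_tau: "i \<le> n \<Longrightarrow> antipode p n (\<tau> p n i) = tau_conj i"
  using is_antipode_antipode by (simp add: is_antipode_iff tau_eq_agen Tau_gens)

end

theorem theorem3p20:
  fixes p n :: nat
  assumes "prime p" and "odd p"
  shows "(\<forall>i j. 1 \<le> i \<longrightarrow> i + j \<le> n \<longrightarrow>
            antipode p n (\<xi> p n i [^]\<^bsub>Adual p n\<^esub> (p ^ j))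
              = signed_path_sum p n (2 * p ^ j) (2 * p ^ (i + j)))
       \<and> (\<forall>i\<le>n. antipode p n (\<tau> p n i) = signed_path_sum p n 1 (2 * p ^ i))"
proof -
  interpret steenrod_quotient p n
    using assms by unfold_locales
  show ?thesis
    using antipode_xi_pow[unfolded xi_conj_def] antipode_tau[unfolded tau_conj_def] by blast
qed

end
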